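(* Let $B: L_2(\mathbb{R})\to L_2(\mathbb{R})$ be an injective, continuous linear operator for which $BB^*-\lambda I$ is injective for $0\le\lambda\le c_0$ for some $c_0>0$. Furthermore, let $\psi$ be a non-negative function which is monotonically increasing for arguments larger than $1/c_0$. Finally, let $\Psi$ be a non-negative function such that $\Psi(\psi(\lambda))\ge\lambda$ and $\Psi$ is monotonically increasing and concave for all arguments $\lambda>1/c_0$. If $f_\alpha\in H_\psi$ satisfies $$\|Bf_\alpha\|_\psi\le C\quad\text{and}\quad \|Bf_\alpha-g\|=\epsilon,$$ then $$\|f-f_\alpha\|\le \epsilon\,\sqrt{\Psi\left((C+\|g\|_\psi)^2/\epsilon^2\right)}$$ for all $f$ and $g=Bf\in H_\psi$.
   Context: $\|\cdot\|$ and $(\cdot,\cdot)$ denote the norm and inner product of $L_2(\mathbb{R})$, and $B^*$ is the adjoint of $B$. $H_\psi$ is the Hilbert space with norm given by $\|g\|_\psi^2=(g,\psi((BB^* )^{-1})g)$, where $\psi$ is a function on (a subset of) $(0,\infty)$ which is continuous and monotonically increasing, and the operator $\psi((BB^* )^{-1})$ is defined using the spectral theorem. $f_\alpha$ denotes a regularised solution of the equation $Bf=g$.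
   Formalization: As printed the claim can fail; here Ψ(ψ(λ)) ≥ λ is required on the whole domain of ψ (which carries the spectrum of (BB* )^{-1}), and Ψ is increasing and concave on a convex set containing all arguments > 1/c_0 and also all values of ψ. *)

theory Defs
  imports "HOL-Analysis.Analysis"
begin

definition square_integrable :: "(real \<Rightarrow> 'a::euclidean_space) \<Rightarrow> bool" where
  "square_integrable f \<longleftrightarrow>
     f \<in> borel_measurable lborel \<and> integrable lborel (\<lambda>x. (norm (f x))\<^sup>2)"

definition L2_eq :: "(real \<Rightarrow> 'a::euclidean_space) \<Rightarrow> (real \<Rightarrow> 'a) \<Rightarrow> bool" where
  "L2_eq f g \<longleftrightarrow> square_integrable f \<and> square_integrable g \<and> (AE x in lborel. f x = g x)"

lemma square_integrable_zero [simp]: "square_integrable (\<lambda>_. 0)"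
  by (simp add: square_integrable_def)

lemma square_integrable_scaleR:
  "square_integrable f \<Longrightarrow> square_integrable (\<lambda>x. c *\<^sub>R f x)"
  by (auto simp: square_integrable_def power_mult_distrib)

lemma square_integrable_add:
  assumes "square_integrable f" "square_integrable g"
  shows "square_integrable (\<lambda>x. f x + g x)"
proof -
  have m: "f \<in> borel_measurable lborel" "g \<in> borel_measurable lborel"
    using assms by (auto simp: square_integrable_def)
  have "integrable lborel (\<lambda>x. (norm (f x + g x))\<^sup>2)"
  proof (rule Bochner_Integration.integrable_bound)
    show "integrable lborel (\<lambda>x. 2 * (norm (f x))\<^sup>2 + 2 * (norm (g x))\<^sup>2)"
      using assms by (auto simp: square_integrable_def)
    show "(\<lambda>x. (norm (f x + g x))\<^sup>2) \<in> borel_measurable lborel"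
      using m by measurable
    have "(norm (f x + g x))\<^sup>2 \<le> 2 * (norm (f x))\<^sup>2 + 2 * (norm (g x))\<^sup>2" for x
    proof -
      have "(norm (f x + g x))\<^sup>2 \<le> (norm (f x) + norm (g x))\<^sup>2"
        by (simp add: norm_triangle_ineq power_mono)
      also have "\<dots> \<le> 2 * (norm (f x))\<^sup>2 + 2 * (norm (g x))\<^sup>2"
        using sum_squares_bound[of "norm (f x)" "norm (g x)"] by (simp add: power2_sum)
      finally show ?thesis .
    qed
    then show "AE x in lborel. norm ((norm (f x + g x))\<^sup>2)
        \<le> norm (2 * (norm (f x))\<^sup>2 + 2 * (norm (g x))\<^sup>2)"
      by (intro AE_I2) (simp add: abs_of_nonneg)
  qed
  then show ?thesis
    using m by (simp add: square_integrable_def)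
qed

lemma square_integrable_uminus:
  "square_integrable f \<Longrightarrow> square_integrable (\<lambda>x. - f x)"
  using square_integrable_scaleR[of f "-1"] by simp

lemma square_integrable_diff:
  "square_integrable f \<Longrightarrow> square_integrable g \<Longrightarrow> square_integrable (\<lambda>x. f x - g x)"
  using square_integrable_add[of f "\<lambda>x. - g x"] square_integrable_uminus[of g] by simp

lemma integrable_inner_L2:
  assumes "square_integrable f" "square_integrable g"
  shows "integrable lborel (\<lambda>x. f x \<bullet> g x)"
proof (rule Bochner_Integration.integrable_bound)
  show "integrable lborel (\<lambda>x. (norm (f x))\<^sup>2 + (norm (g x))\<^sup>2)"
    using assms by (auto simp: square_integrable_def)
  show "(\<lambda>x. f x \<bullet> g x) \<in> borel_measurable lborel"
    using assms by (auto simp: square_integrable_def)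
  have "\<bar>f x \<bullet> g x\<bar> \<le> (norm (f x))\<^sup>2 + (norm (g x))\<^sup>2" for x
  proof -
    have "\<bar>f x \<bullet> g x\<bar> \<le> norm (f x) * norm (g x)"
      by (rule Cauchy_Schwarz_ineq2)
    also have "\<dots> \<le> 2 * norm (f x) * norm (g x)"
      by simp
    also have "\<dots> \<le> (norm (f x))\<^sup>2 + (norm (g x))\<^sup>2"
      by (rule sum_squares_bound)
    finally show ?thesis .
  qed
  then show "AE x in lborel. norm (f x \<bullet> g x) \<le> norm ((norm (f x))\<^sup>2 + (norm (g x))\<^sup>2)"
    by (intro AE_I2) (simp add: abs_of_nonneg)
qed

text \<open>\<open>real L2\<close> and \<open>complex L2\<close> are the spaces of real-valued and of complex-valued square-integrable
  functions on the real line, modulo equality almost everywhere. For \<open>complex L2\<close> the inner product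
  below is the real part of the usual one; norms, adjoints of complex-linear operators and
  quadratic forms of self-adjoint operators are the same for both.\<close>

quotient_type (overloaded) 'a L2 = "real \<Rightarrow> 'a::euclidean_space" / partial: L2_eq
  morphisms rep_L2 abs_L2
proof (rule part_equivpI)
  show "\<exists>f :: real \<Rightarrow> 'a. L2_eq f f"
    by (rule exI[of _ "\<lambda>_. 0"]) (simp add: L2_eq_def)
  show "symp (L2_eq :: (real \<Rightarrow> 'a) \<Rightarrow> _)"
    by (auto simp: symp_def L2_eq_def)
  show "transp (L2_eq :: (real \<Rightarrow> 'a) \<Rightarrow> _)"
    by (auto simp: transp_def L2_eq_def)
qed

instantiation L2 :: (euclidean_space) real_inner
begin

lift_definition zero_L2 :: "'a L2" is "\<lambda>_. 0"
  by (simp add: L2_eq_def)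

lift_definition plus_L2 :: "'a L2 \<Rightarrow> 'a L2 \<Rightarrow> 'a L2" is "\<lambda>f g x. f x + g x"
  by (auto simp: L2_eq_def square_integrable_add)

lift_definition uminus_L2 :: "'a L2 \<Rightarrow> 'a L2" is "\<lambda>f x. - f x"
  by (auto simp: L2_eq_def square_integrable_uminus)

lift_definition minus_L2 :: "'a L2 \<Rightarrow> 'a L2 \<Rightarrow> 'a L2" is "\<lambda>f g x. f x - g x"
  by (auto simp: L2_eq_def square_integrable_diff)

lift_definition scaleR_L2 :: "real \<Rightarrow> 'a L2 \<Rightarrow> 'a L2" is "\<lambda>c f x. c *\<^sub>R f x"
  by (auto simp: L2_eq_def square_integrable_scaleR)

lift_definition inner_L2 :: "'a L2 \<Rightarrow> 'a L2 \<Rightarrow> real" is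
  "\<lambda>f g. integral\<^sup>L lborel (\<lambda>x. f x \<bullet> g x)"
proof -
  fix f f' g g' :: "real \<Rightarrow> 'a"
  assume "L2_eq f f'" "L2_eq g g'"
  then show "integral\<^sup>L lborel (\<lambda>x. f x \<bullet> g x) = integral\<^sup>L lborel (\<lambda>x. f' x \<bullet> g' x)"
    by (intro integral_cong_AE) (auto simp: L2_eq_def square_integrable_def)
qed

definition norm_L2 :: "'a L2 \<Rightarrow> real" where
  "norm_L2 f = sqrt (f \<bullet> f)"

definition dist_L2 :: "'a L2 \<Rightarrow> 'a L2 \<Rightarrow> real" where
  "dist_L2 f g = norm (f - g)"

definition sgn_L2 :: "'a L2 \<Rightarrow> 'a L2" where
  "sgn_L2 f = inverse (norm f) *\<^sub>R f"

definition uniformity_L2 :: "('a L2 \<times> 'a L2) filter" where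
  "uniformity_L2 = (INF e\<in>{0<..}. principal {(f, g). dist f g < e})"

definition open_L2 :: "'a L2 set \<Rightarrow> bool" where
  "open_L2 U \<longleftrightarrow> (\<forall>x\<in>U. eventually (\<lambda>(x', y). x' = x \<longrightarrow> y \<in> U) uniformity)"

instance
proof
  fix f g h :: "'a L2" and a b :: real and U :: "'a L2 set"
  show "f + g + h = f + (g + h)"
    by transfer (auto simp: L2_eq_def square_integrable_add add.assoc)
  show "f + g = g + f"
    by transfer (auto simp: L2_eq_def square_integrable_add add.commute)
  show "0 + f = f"
    by transfer (auto simp: L2_eq_def)
  show "- f + f = 0"
    by transfer (auto simp: L2_eq_def)
  show "f - g = f + - g"
    by transfer (auto simp: L2_eq_def square_integrable_diff)
  show "a *\<^sub>R (f + g) = a *\<^sub>R f + a *\<^sub>R g"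
    by transfer
      (auto simp: L2_eq_def scaleR_add_right intro!: square_integrable_scaleR square_integrable_add)
  show "(a + b) *\<^sub>R f = a *\<^sub>R f + b *\<^sub>R f"
    by transfer
      (auto simp: L2_eq_def scaleR_add_left intro!: square_integrable_scaleR square_integrable_add)
  show "a *\<^sub>R b *\<^sub>R f = (a * b) *\<^sub>R f"
    by transfer (auto simp: L2_eq_def square_integrable_scaleR)
  show "1 *\<^sub>R f = f"
    by transfer (auto simp: L2_eq_def)
  show "dist f g = norm (f - g)"
    by (rule dist_L2_def)
  show "sgn f = inverse (norm f) *\<^sub>R f"
    by (rule sgn_L2_def)
  show "uniformity = (INF e\<in>{0<..}. principal {(f :: 'a L2, g). dist f g < e})"
    by (rule uniformity_L2_def)
  show "open U \<longleftrightarrow> (\<forall>x\<in>U. eventually (\<lambda>(x', y). x' = x \<longrightarrow> y \<in> U) uniformity)"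
    by (rule open_L2_def)
  show "f \<bullet> g = g \<bullet> f"
    by transfer (simp add: inner_commute)
  show "(f + g) \<bullet> h = f \<bullet> h + g \<bullet> h"
    by transfer (simp add: L2_eq_def inner_add_left integrable_inner_L2)
  show "a *\<^sub>R f \<bullet> g = a * (f \<bullet> g)"
    by transfer simp
  show "0 \<le> f \<bullet> f"
    by transfer simp
  show "f \<bullet> f = 0 \<longleftrightarrow> f = 0"
  proof transfer
    fix f :: "real \<Rightarrow> 'a"
    assume "L2_eq f f"
    then have f: "square_integrable f"
      by (simp add: L2_eq_def)
    have "integral\<^sup>L lborel (\<lambda>x. f x \<bullet> f x) = 0 \<longleftrightarrow> (AE x in lborel. f x \<bullet> f x = 0)"
      by (rule integral_nonneg_eq_0_iff_AE[OF integrable_inner_L2[OF f f]]) simp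
    then show "integral\<^sup>L lborel (\<lambda>x. f x \<bullet> f x) = 0 \<longleftrightarrow> L2_eq f (\<lambda>_. 0)"
      using f by (simp add: L2_eq_def)
  qed
  show "norm f = sqrt (f \<bullet> f)"
    by (rule norm_L2_def)
qed

end

text \<open>The scalar measure \<open>A \<mapsto> (x, E(A) x)\<close> of a projection-valued measure \<open>E\<close>.\<close>

definition scalar_measure :: "(real set \<Rightarrow> 'h::real_inner \<Rightarrow> 'h) \<Rightarrow> 'h \<Rightarrow> real measure" where
  "scalar_measure E x = measure_of UNIV (sets borel) (\<lambda>A. ennreal (x \<bullet> E A x))"

definition projection_valued_measure :: "(real set \<Rightarrow> 'h::real_inner \<Rightarrow> 'h) \<Rightarrow> bool" where
  "projection_valued_measure E \<longleftrightarrow>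
     (\<forall>A\<in>sets borel. bounded_linear (E A) \<and> E A \<circ> E A = E A \<and>
        (\<forall>x y. E A x \<bullet> y = x \<bullet> E A y)) \<and>
     E UNIV = id \<and>
     (\<forall>A x. range A \<subseteq> sets borel \<longrightarrow> disjoint_family A \<longrightarrow>
        (\<lambda>n::nat. E (A n) x) sums E (\<Union>n. A n) x)"

text \<open>\<open>T = \<integral> t dE(t)\<close> in the weak sense, for bounded self-adjoint \<open>T\<close>.\<close>

definition spectral_resolution ::
    "('h::real_inner \<Rightarrow> 'h) \<Rightarrow> (real set \<Rightarrow> 'h \<Rightarrow> 'h) \<Rightarrow> bool" where
  "spectral_resolution T E \<longleftrightarrow> projection_valued_measure E \<and>
     (\<forall>x. integrable (scalar_measure E x) (\<lambda>t. t) \<and>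
          x \<bullet> T x = integral\<^sup>L (scalar_measure E x) (\<lambda>t. t))"

text \<open>By the spectral theorem a resolution exists and its values on Borel sets are unique, so the
  choice is immaterial.\<close>

definition spectral_measure :: "('h::real_inner \<Rightarrow> 'h) \<Rightarrow> 'h \<Rightarrow> real measure" where
  "spectral_measure T x = scalar_measure (SOME E. spectral_resolution T E) x"

text \<open>For \<open>T = B B\<^sup>*\<close> injective, \<open>\<psi>(T\<^sup>-\<^sup>1) = \<integral> \<psi>(1/t) dE(t)\<close> with \<open>E\<close> the resolution of \<open>T\<close>, so
  \<open>(g, \<psi>(T\<^sup>-\<^sup>1) g)\<close> is the integral of \<open>\<psi>(1/t)\<close> against the spectral measure of \<open>T\<close> at \<open>g\<close>. The set
  \<open>D\<close> is the domain of \<open>\<psi>\<close>, a subset of the positive reals. The real-valued norm is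
  meaningful only on \<open>H_space\<close>.\<close>

definition H_space ::
    "('a L2 \<Rightarrow> 'a L2) \<Rightarrow> real set \<Rightarrow> (real \<Rightarrow> real) \<Rightarrow> 'a::euclidean_space L2 set" where
  "H_space B D \<psi> =
     {g. set_integrable (spectral_measure (B \<circ> adjoint B) g) {t. 1 / t \<in> D} (\<lambda>t. \<psi> (1 / t))}"

definition H_norm ::
    "('a L2 \<Rightarrow> 'a L2) \<Rightarrow> real set \<Rightarrow> (real \<Rightarrow> real) \<Rightarrow> 'a::euclidean_space L2 \<Rightarrow> real" where
  "H_norm B D \<psi> g =
     sqrt (set_lebesgue_integral (spectral_measure (B \<circ> adjoint B) g) {t. 1 / t \<in> D} (\<lambda>t. \<psi> (1 / t)))"

end

theory Submission
  imports Defs "HOL-Probability.Helly_Selection" "HOL-Probability.Giry_Monad"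
begin

text \<open>Put \<open>h = f - f\<^sub>\<alpha>\<close> and \<open>T = B B\<^sup>*\<close>, let \<open>E\<close> be the spectral resolution of \<open>T\<close> and \<open>\<mu>\<close> the
measure \<open>A \<mapsto> (B h, E(A) B h)\<close>. Its total mass is \<open>\<parallel>B h\<parallel>\<^sup>2 = \<epsilon>\<^sup>2\<close>, and it lives on \<open>t > 0\<close>. The
estimate combines three facts.

First, \<open>\<parallel>h\<parallel>\<^sup>2 \<le> \<integral> 1/t d\<mu>\<close> (lemma \<open>norm_le_integral_inverse\<close>); formally this is \<open>\<parallel>h\<parallel>\<^sup>2 = (B h,
T\<^sup>-\<^sup>1 B h)\<close>. It is obtained without unbounded operators, from the duality \<open>2 (B h, y) \<le> \<integral> 1/t d\<mu>
+ (y, T y)\<close>, whose last term is \<open>\<parallel>B\<^sup>* y\<parallel>\<^sup>2\<close>, together with the density of the range of \<open>B\<^sup>*\<close>,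
which is the injectivity of \<open>B\<close>. Secondly, \<open>1/t \<le> \<Psi>(\<psi>(1/t))\<close>, so that Jensen's inequality for
the concave \<open>\<Psi>\<close> bounds this integral by \<open>\<epsilon>\<^sup>2 \<Psi>(m)\<close>, where \<open>m\<close> is the mean of \<open>\<psi>(1/t)\<close> (lemma
\<open>integral_le_concave_mean\<close>). Thirdly, \<open>\<epsilon>\<^sup>2 m = \<parallel>g - B f\<^sub>\<alpha>\<parallel>\<^sub>\<psi>\<^sup>2 \<le> (C + \<parallel>g\<parallel>\<^sub>\<psi>)\<^sup>2\<close> by the triangle
inequality for the \<open>\<psi>\<close>-norm (lemma \<open>scalar_measure_triangle\<close>), and \<open>\<Psi>\<close> is increasing.

All of this needs the resolution \<open>E\<close> to exist, that is, the spectral theorem for the positive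
operator \<open>T\<close>. The proof given here goes through the moment problem. The Bernstein polynomials of
\<open>T\<close> are positive operators, so for each \<open>x\<close> they give discrete measures; by Helly's theorem a
subsequence has a weak limit \<open>\<mu>\<^sub>x\<close>, which satisfies \<open>\<integral> p d\<mu>\<^sub>x = (x, p(T) x)\<close> for all polynomials
\<open>p\<close>. Hence \<open>p \<mapsto> p(T) x\<close> is an isometry for the norm of \<open>L\<^sup>2(\<mu>\<^sub>x)\<close>, in which polynomials are
dense, and \<open>E(A) x\<close> is the limit of \<open>p\<^sub>n(T) x\<close> for polynomials \<open>p\<^sub>n\<close> tending to the indicator
function of \<open>A\<close>. Approximating in finitely many of these spaces simultaneously transfers
linearity and symmetry from \<open>p\<^sub>n(T)\<close> to \<open>E(A)\<close>, and \<open>\<parallel>E(A) x\<parallel>\<^sup>2 = \<mu>\<^sub>x(A) = (x, E(A) x)\<close> makes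
\<open>E(A)\<close> idempotent. The Hilbert space arguments rest on completeness of the space of
square-integrable functions, which is the Riesz-Fischer theorem.\<close>

section \<open>Riesz representation, adjoints and density in real Hilbert spaces\<close>

text \<open>The representing vector minimises \<open>\<parallel>v\<parallel>\<^sup>2 - 2 \<phi> v\<close> over the closure of \<open>V\<close>. This covers both
the Riesz representation theorem (\<open>V\<close> the whole space) and the orthogonal projection onto the
closure of \<open>V\<close> (\<open>\<phi>\<close> an inner product).\<close>

lemma riesz_on_subspace:
  fixes \<phi> :: "'h::{real_inner, complete_space} \<Rightarrow> real"
  assumes V: "subspace V" and \<phi>: "bounded_linear \<phi>"
  obtains w where "w \<in> closure V" "\<And>v. v \<in> V \<Longrightarrow> \<phi> v = w \<bullet> v"
proof -
  interpret \<phi>: bounded_linear \<phi> by fact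
  define J where "J v = (norm v)\<^sup>2 - 2 * \<phi> v" for v
  obtain K where K: "\<And>v. \<bar>\<phi> v\<bar> \<le> norm v * K"
    using \<phi>.bounded by auto
  have lower: "- K\<^sup>2 \<le> J v" for v
  proof -
    have "\<phi> v \<le> norm v * K" using K[of v] by linarith
    moreover have "0 \<le> (norm v - K)\<^sup>2" by simp
    ultimately show ?thesis by (simp add: J_def power2_diff)
  qed
  define m where "m = Inf (J ` V)"
  have bdd: "bdd_below (J ` V)" using lower by (auto intro!: bdd_belowI)
  have m_le: "m \<le> J v" if "v \<in> V" for v
    unfolding m_def using bdd that by (auto intro: cInf_lower)
  have ne: "J ` V \<noteq> {}" using subspace_0[OF V] by auto
  have "\<exists>v\<in>V. J v < m + inverse (real (Suc n))" for n
    using cInf_lessD[OF ne, of "m + inverse (real (Suc n))"] unfolding m_def by auto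
  then obtain v where v: "\<And>n. v n \<in> V" "\<And>n. J (v n) < m + inverse (real (Suc n))"
    by metis
  \<comment> \<open>The functional is quadratic, so the parallelogram law makes minimising sequences Cauchy.\<close>
  have mid: "(norm (a - b))\<^sup>2 \<le> 2 * (J a - m) + 2 * (J b - m)" if "a \<in> V" "b \<in> V" for a b
  proof -
    have "m \<le> J ((1/2) *\<^sub>R (a + b))"
      using V that by (intro m_le) (auto intro: subspace_scale subspace_add)
    moreover have "(norm (a - b))\<^sup>2 = 2 * J a + 2 * J b - 4 * J ((1/2) *\<^sub>R (a + b))"
      by (simp add: J_def power2_norm_eq_inner inner_add_left inner_add_right inner_diff_left
        inner_diff_right inner_commute \<phi>.scaleR \<phi>.add power_divide algebra_simps)
    ultimately show ?thesis by simp
  qed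
  have "Cauchy v"
  proof (rule metric_CauchyI)
    fix e :: real assume e: "e > 0"
    obtain N where N: "inverse (real (Suc N)) < e\<^sup>2 / 4"
      using reals_Archimedean[of "e\<^sup>2 / 4"] e by auto
    have "dist (v i) (v j) < e" if "i \<ge> N" "j \<ge> N" for i j
    proof -
      have *: "J (v k) - m < e\<^sup>2 / 4" if "k \<ge> N" for k
      proof -
        have "inverse (real (Suc k)) \<le> inverse (real (Suc N))" using that by simp
        then show ?thesis using v(2)[of k] N by linarith
      qed
      have "(norm (v i - v j))\<^sup>2 < e\<^sup>2"
        using mid[OF v(1) v(1), of i j] *[OF that(1)] *[OF that(2)] by argo
      then show ?thesis
        using e by (simp add: dist_norm power2_less_imp_less)
    qed
    then show "\<exists>N. \<forall>i\<ge>N. \<forall>j\<ge>N. dist (v i) (v j) < e" by blast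
  qed
  then obtain w where w: "v \<longlonglongrightarrow> w" using Cauchy_convergent convergent_def by blast
  have wV: "w \<in> closure V" using v(1) w by (auto simp: closure_sequential)
  have Jv: "(\<lambda>n. J (v n + z)) \<longlonglongrightarrow> J (w + z)" for z
    unfolding J_def by (intro tendsto_intros w \<phi>.tendsto)
  have "(\<lambda>n. m + inverse (real (Suc n))) \<longlonglongrightarrow> m + 0"
    by (intro tendsto_intros LIMSEQ_inverse_real_of_nat)
  with Jv[of 0] have Jw: "J w \<le> m"
    using v(2) by (intro LIMSEQ_le[OF _ \<open>_ \<longlonglongrightarrow> m + 0\<close>, simplified])
      (auto intro: less_imp_le)
  have Jw': "m \<le> J (w + z)" if "z \<in> V" for z
    using v(1) that V by (intro LIMSEQ_le_const[OF Jv[of z]]) (auto intro!: m_le subspace_add)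
  have "\<phi> z = w \<bullet> z" if z: "z \<in> V" for z
  proof -
    define c where "c = w \<bullet> z - \<phi> z"
    have ineq: "0 \<le> 2 * t * c + t\<^sup>2 * (norm z)\<^sup>2" for t
    proof -
      have "J w \<le> J (w + t *\<^sub>R z)" using Jw Jw'[of "t *\<^sub>R z"] z V subspace_scale by force
      moreover have "(norm (w + t *\<^sub>R z))\<^sup>2 = (norm w)\<^sup>2 + 2 * t * (w \<bullet> z) + t\<^sup>2 * (norm z)\<^sup>2"
        by (simp add: power2_norm_eq_inner inner_add_left inner_add_right inner_commute)
          (simp add: power2_eq_square)
      ultimately show ?thesis
        by (simp add: J_def c_def \<phi>.scaleR \<phi>.add algebra_simps)
    qed
    have "c = 0"
    proof (rule ccontr)
      assume "c \<noteq> 0"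
      \<comment> \<open>The step \<open>- c / q\<close> nearly minimises the quadratic in \<open>t\<close>, and \<open>q\<close> is positive even if \<open>z = 0\<close>.\<close>
      define q where "q = (norm z)\<^sup>2 + 1"
      have q: "q > 0" by (simp add: q_def add_nonneg_pos)
      have "(- c / q)\<^sup>2 * (norm z)\<^sup>2 \<le> (- c / q)\<^sup>2 * q"
        by (intro mult_left_mono) (auto simp: q_def)
      also have "\<dots> = c\<^sup>2 / q" using q by (simp add: power2_eq_square)
      finally have "0 \<le> 2 * (- c / q) * c + c\<^sup>2 / q" using ineq[of "- c / q"] by linarith
      also have "\<dots> = - (c\<^sup>2 / q)" by (simp add: power2_eq_square)
      finally show False using \<open>c \<noteq> 0\<close> q by (simp add: zero_le_divide_iff divide_le_0_iff)
    qed
    then show ?thesis by (simp add: c_def)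
  qed
  with wV that show ?thesis by blast
qed

text \<open>The constant \<open>adjoint\<close> is an arbitrary choice of an adjoint; in infinite dimension that an
adjoint exists at all is the content of the Riesz representation theorem.\<close>

lemma inner_adjoint_hilbert:
  fixes B :: "'h::{real_inner, complete_space} \<Rightarrow> 'k::real_inner"
  assumes "bounded_linear B"
  shows "B x \<bullet> y = x \<bullet> adjoint B y"
proof -
  interpret bounded_linear B by fact
  have "\<exists>w. \<forall>x. B x \<bullet> y = x \<bullet> w" for y
  proof -
    have "bounded_linear (\<lambda>x. B x \<bullet> y)"
      using bounded_linear_compose[OF bounded_linear_inner_left assms] by simp
    then obtain w where "\<And>v. v \<in> UNIV \<Longrightarrow> B v \<bullet> y = w \<bullet> v"
      using riesz_on_subspace[OF subspace_UNIV] by metis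
    then show ?thesis by (metis UNIV_I inner_commute)
  qed
  then have "\<exists>f'. \<forall>x y. B x \<bullet> y = x \<bullet> f' y" by metis
  then show ?thesis unfolding adjoint_def by (rule someI2_ex) blast
qed

lemma dense_subspaceI:
  fixes V :: "'h::{real_inner, complete_space} set"
  assumes V: "subspace V" and perp: "\<And>h. (\<And>v. v \<in> V \<Longrightarrow> h \<bullet> v = 0) \<Longrightarrow> h = 0"
  shows "closure V = UNIV"
proof -
  have "h \<in> closure V" for h
  proof -
    obtain w where w: "w \<in> closure V" "\<And>v. v \<in> V \<Longrightarrow> h \<bullet> v = w \<bullet> v"
      using riesz_on_subspace[OF V bounded_linear_inner_right] by metis
    then have "h - w = 0" by (intro perp) (simp add: inner_diff_left)
    with w show ?thesis by simp
  qed
  then show ?thesis by blast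
qed

lemma bounded_linear_adjoint:
  fixes B :: "'h::{real_inner, complete_space} \<Rightarrow> 'k::real_inner"
  assumes "bounded_linear B"
  shows "bounded_linear (adjoint B)"
proof -
  note adj = inner_adjoint_hilbert[OF assms]
  obtain K where "K \<ge> 0" and K: "\<And>x. norm (B x) \<le> norm x * K"
    using bounded_linear.nonneg_bounded[OF assms] by blast
  show ?thesis
  proof (rule bounded_linear_intro)
    show "adjoint B (x + y) = adjoint B x + adjoint B y" for x y
      by (rule vector_eq_rdot[THEN iffD1]) (metis (no_types) adj inner_add_left inner_commute)
    show "adjoint B (r *\<^sub>R x) = r *\<^sub>R adjoint B x" for r x
      by (rule vector_eq_rdot[THEN iffD1]) (metis (no_types) adj inner_scaleR_left inner_commute)
    show "norm (adjoint B y) \<le> norm y * K" for y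
    proof (cases "adjoint B y = 0")
      case True
      then show ?thesis using \<open>K \<ge> 0\<close> by simp
    next
      case False
      have "(norm (adjoint B y))\<^sup>2 = B (adjoint B y) \<bullet> y" by (simp add: adj power2_norm_eq_inner)
      also have "\<dots> \<le> norm (B (adjoint B y)) * norm y" by (rule norm_cauchy_schwarz)
      also have "\<dots> \<le> (norm (adjoint B y) * K) * norm y" by (intro mult_right_mono K) simp
      finally show ?thesis using False by (simp add: power2_eq_square mult.assoc mult.commute)
    qed
  qed
qed

section \<open>Polynomials of a linear operator\<close>

definition poly_op :: "('h::real_vector \<Rightarrow> 'h) \<Rightarrow> real poly \<Rightarrow> 'h \<Rightarrow> 'h" where
  "poly_op T p x = fold_coeffs (\<lambda>a y. a *\<^sub>R x + T y) p 0"

lemma poly_op_0 [simp]: "poly_op T 0 x = 0"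
  by (simp add: poly_op_def)

context
  fixes T :: "'h::real_vector \<Rightarrow> 'h"
  assumes T: "linear T"
begin

interpretation T: linear T by (rule T)

lemma poly_op_pCons: "poly_op T (pCons a p) x = a *\<^sub>R x + T (poly_op T p x)"
proof (cases "a = 0 \<and> p = 0")
  case False
  then show ?thesis
    by (auto simp: poly_op_def fold_coeffs_pCons_coeff_not_0_eq fold_coeffs_pCons_not_0_0_eq)
qed (simp add: T.zero)

lemma poly_op_1 [simp]: "poly_op T 1 x = x"
  by (simp add: one_pCons poly_op_pCons T.zero)

lemma poly_op_add: "poly_op T (p + q) x = poly_op T p x + poly_op T q x"
proof (induction p arbitrary: q)
  case (pCons a p)
  then show ?case
    by (cases q) (simp add: poly_op_pCons T.add scaleR_add_left)
qed simp

lemma poly_op_smult: "poly_op T (smult c p) x = c *\<^sub>R poly_op T p x"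
  by (induction p) (simp_all add: poly_op_pCons T.scale scaleR_add_right)

lemma poly_op_diff: "poly_op T (p - q) x = poly_op T p x - poly_op T q x"
  using poly_op_add[of p "smult (-1) q" x] poly_op_smult[of "-1" q x] by simp

lemma poly_op_sum: "poly_op T (\<Sum>i\<in>I. p i) x = (\<Sum>i\<in>I. poly_op T (p i) x)"
  by (induction I rule: infinite_finite_induct) (simp_all add: poly_op_add)

lemma poly_op_mult: "poly_op T (p * q) x = poly_op T p (poly_op T q x)"
  by (induction p) (simp_all add: poly_op_pCons poly_op_add poly_op_smult)

lemma linear_poly_op: "linear (poly_op T p)"
proof (induction p)
  case 0
  then show ?case by (auto intro!: linearI)
next
  case (pCons a p)
  then show ?case
    by (auto intro!: linearI simp: poly_op_pCons linear_add linear_scale T.add T.scale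
      scaleR_add_right)
qed

end

lemma inner_poly_op:
  fixes T :: "'h::real_inner \<Rightarrow> 'h"
  assumes T: "linear T" and sym: "\<And>x y. T x \<bullet> y = x \<bullet> T y"
  shows "poly_op T p x \<bullet> y = x \<bullet> poly_op T p y"
proof (induction p arbitrary: x y)
  case (pCons a p)
  have "T (poly_op T p x) \<bullet> y = x \<bullet> poly_op T p (T y)"
    by (simp add: sym pCons.IH)
  also have "poly_op T p (T y) = T (poly_op T p y)"
    using poly_op_mult[OF T, of p "[:0, 1:]" y] poly_op_mult[OF T, of "[:0, 1:]" p y]
    by (simp add: poly_op_pCons[OF T] linear_0[OF T] mult.commute)
  finally show ?case
    by (simp add: poly_op_pCons[OF T] inner_add_left inner_add_right)
qed simp

section \<open>Bernstein polynomials of a positive operator and the moment problem\<close>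

text \<open>The ratio \<open>(k choose m) / (n choose m)\<close> is \<open>k (k - 1) \<cdots> (k - m + 1) / (n (n - 1) \<cdots> (n - m +
1))\<close>, and for large \<open>n\<close> each factor is close to \<open>k / n\<close>. Bernstein sums reproduce the former
exactly (\<open>bernstein_moment\<close> below), whereas the moments of the discrete measures are formed with
the latter.\<close>

lemma choose_ratio_approx:
  assumes "k \<le> n" "m < n"
  shows "\<bar>real (k choose m) / real (n choose m) - (real k / real n) ^ m\<bar>
    \<le> real m * (real m / real (n - m))"
proof -
  have eq: "real (k choose m) / real (n choose m) = (\<Prod>i<m. real (k - i) / real (n - i))"
  proof (cases "m \<le> k")
    case True
    have "real (k choose m) / real (n choose m)
        = (\<Prod>i<m. real (k - i) / real (m - i)) / (\<Prod>i<m. real (n - i) / real (m - i))"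
      using True assms by (simp add: binomial_altdef_of_nat atLeast0LessThan)
    also have "\<dots> = (\<Prod>i<m. (real (k - i) / real (m - i)) / (real (n - i) / real (m - i)))"
      by (simp add: prod_dividef)
    also have "\<dots> = (\<Prod>i<m. real (k - i) / real (n - i))"
      by (intro prod.cong) auto
    finally show ?thesis .
  next
    case False
    then have "(\<Prod>i<m. real (k - i) / real (n - i)) = 0"
      by (intro prod_zero) (auto intro!: bexI[of _ k])
    then show ?thesis using False by (simp add: binomial_eq_0)
  qed
  have "(real k / real n) ^ m = (\<Prod>i<m. real k / real n)" by simp
  then have "\<bar>real (k choose m) / real (n choose m) - (real k / real n) ^ m\<bar>
      = norm ((\<Prod>i<m. real (k - i) / real (n - i)) - (\<Prod>i<m. real k / real n))"
    using eq by simp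
  also have "\<dots> \<le> (\<Sum>i<m. norm (real (k - i) / real (n - i) - real k / real n))"
    using assms by (intro norm_prod_diff) (auto simp: divide_le_eq)
  also have "\<dots> \<le> (\<Sum>i<m. real m / real (n - m))"
  proof (rule sum_mono)
    fix i assume "i \<in> {..<m}"
    then have i: "i < m" by simp
    have mono: "real i / real (n - i) \<le> real m / real (n - m)"
      using i assms by (intro frac_le) auto
    show "norm (real (k - i) / real (n - i) - real k / real n) \<le> real m / real (n - m)"
    proof (cases "i \<le> k")
      case True
      have "real k / real n - real (k - i) / real (n - i)
          = real i / real (n - i) * ((real n - real k) / real n)"
        using True i assms by (simp add: of_nat_diff field_simps)
      moreover have "0 \<le> real i / real (n - i) * ((real n - real k) / real n)"
        using assms by simp
      moreover have "real i / real (n - i) * ((real n - real k) / real n) \<le> real i / real (n - i)"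
        using assms by (intro mult_left_le) auto
      ultimately show ?thesis using mono by simp
    next
      case False
      have "real k / real n \<le> real i / real (n - i)"
        using False i assms by (intro frac_le) auto
      then show ?thesis using False mono by simp
    qed
  qed
  finally show ?thesis by simp
qed

locale positive_operator =
  fixes T :: "'h::{real_inner, complete_space} \<Rightarrow> 'h" and M :: real
  assumes linear: "linear T"
    and symmetric: "\<And>x y. T x \<bullet> y = x \<bullet> T y"
    and nonneg: "\<And>x. 0 \<le> x \<bullet> T x"
    and upper: "\<And>x. x \<bullet> T x \<le> M * (x \<bullet> x)"
    and M_pos: "0 < M"
begin

lemmas poly_op_simps = poly_op_pCons[OF linear] poly_op_1[OF linear] poly_op_add[OF linear]
  poly_op_smult[OF linear] poly_op_diff[OF linear] poly_op_sum[OF linear] linear_0[OF linear]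
  linear_scale[OF linear] linear_neg[OF linear]

definition bernstein :: "nat \<Rightarrow> nat \<Rightarrow> real poly" where
  "bernstein n k = smult (real (n choose k)) ([:0, 1 / M:] ^ k * [:1, - 1 / M:] ^ (n - k))"

text \<open>Square roots are avoided: up to an even power, which conjugates by a self-adjoint operator,
a product of powers of \<open>u = T / M\<close> and \<open>v = 1 - T / M\<close> is one of \<open>1\<close>, \<open>u\<close>, \<open>v\<close>, \<open>u v\<close>.\<close>

lemma bernstein_op_nonneg: "0 \<le> x \<bullet> poly_op T (bernstein n k) x"
proof -
  define u v where "u = [:0, 1 / M:]" and "v = [:1, - 1 / M:]"
  define P where "P p \<longleftrightarrow> (\<forall>x. 0 \<le> x \<bullet> poly_op T p x)" for p
  have conj: "P (r\<^sup>2 * p)" if "P p" for r p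
  proof -
    have "poly_op T (r\<^sup>2 * p) x = poly_op T r (poly_op T p (poly_op T r x))" for x
      by (simp flip: poly_op_mult[OF linear] add: power2_eq_square mult_ac)
    moreover have "x \<bullet> poly_op T r y = poly_op T r x \<bullet> y" for x y
      by (rule inner_poly_op[OF linear symmetric, symmetric])
    ultimately show ?thesis using that by (simp add: P_def)
  qed
  have add: "P (p + q)" if "P p" "P q" for p q
    using that by (simp add: P_def poly_op_simps inner_add_right)
  have P1: "P 1" by (simp add: P_def poly_op_simps)
  have Pu: "P u" using nonneg M_pos by (simp add: P_def u_def poly_op_simps)
  have Pv: "P v"
    using upper M_pos by (simp add: P_def v_def poly_op_simps inner_diff_right field_simps)
  have "u + v = 1" by (simp add: u_def v_def one_pCons)
  \<comment> \<open>The product of the two commuting positive operators is a sum of positive ones.\<close>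
  then have "u * v = u * v * (u + v)" by simp
  then have "u * v = v\<^sup>2 * u + u\<^sup>2 * v"
    by (simp only: distrib_left power2_eq_square mult_ac add.commute)
  then have Puv: "P (u * v)" using add[OF conj[OF Pu, of v] conj[OF Pv, of u]] by simp
  have "P (u ^ k * v ^ j)" for k j
  proof -
    have split: "a ^ i = (a ^ (i div 2))\<^sup>2 * a ^ (i mod 2)" for a :: "real poly" and i
      by (simp flip: power_mult power_add add: mult.commute)
    have "u ^ k * v ^ j = (u ^ (k div 2) * v ^ (j div 2))\<^sup>2 * (u ^ (k mod 2) * v ^ (j mod 2))"
      by (subst split[of u k], subst split[of v j]) (simp only: power_mult_distrib mult_ac)
    moreover have "P (u ^ (k mod 2) * v ^ (j mod 2))"
      using P1 Pu Pv Puv by (cases "even k"; cases "even j") (simp_all add: mod_2_eq_odd)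
    ultimately show ?thesis using conj by simp
  qed
  then show ?thesis
    by (simp add: P_def bernstein_def u_def v_def poly_op_simps)
qed

text \<open>The exact sampling identity behind the convergence of Bernstein polynomials: by \<open>(k choose
m) (n choose k) = (n choose m) (n - m choose k - m)\<close> the sum is \<open>u ^ m (u + v) ^ (n - m)\<close>.\<close>

lemma bernstein_moment:
  assumes "m \<le> n"
  shows "(\<Sum>k\<le>n. smult (real (k choose m) / real (n choose m)) (bernstein n k)) = [:0, 1 / M:] ^ m"
proof -
  define u v where "u = [:0, 1 / M:]" and "v = [:1, - 1 / M:]"
  have uv: "u + v = 1" by (simp add: u_def v_def one_pCons)
  let ?t = "\<lambda>k. smult (real (k choose m) / real (n choose m)) (bernstein n k)"
  have "(\<Sum>k\<le>n. ?t k) = (\<Sum>k=m..n. ?t k)"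
    by (rule sum.mono_neutral_right) auto
  also have "\<dots> = (\<Sum>j\<le>n - m. ?t (j + m))"
    using assms by (intro sum.reindex_bij_witness[of _ "\<lambda>j. j + m" "\<lambda>k. k - m"]) auto
  also have "\<dots> = (\<Sum>j\<le>n - m. u ^ m * (of_nat (n - m choose j) * u ^ j * v ^ (n - m - j)))"
  proof (rule sum.cong[OF refl])
    fix j assume "j \<in> {..n - m}"
    then have j: "j + m \<le> n" using assms by simp
    have "(n choose (j + m)) * ((j + m) choose m) = (n choose m) * (n - m choose j)"
      using choose_mult[of m "j + m" n] j by simp
    then have "real ((j + m) choose m) * real (n choose (j + m))
        = real (n choose m) * real (n - m choose j)"
      by (metis mult.commute of_nat_mult)
    moreover have "real (n choose m) \<noteq> 0" using assms by simp
    ultimately have "real ((j + m) choose m) / real (n choose m) * real (n choose (j + m))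
        = real (n - m choose j)"
      by (simp add: field_simps)
    then have "?t (j + m) = smult (real (n - m choose j)) (u ^ (j + m) * v ^ (n - (j + m)))"
      by (simp add: bernstein_def u_def v_def)
    also have "\<dots> = of_nat (n - m choose j) * (u ^ (j + m) * v ^ (n - (j + m)))"
      by (simp add: of_nat_poly)
    also have "\<dots> = u ^ m * (of_nat (n - m choose j) * u ^ j * v ^ (n - m - j))"
      by (simp add: power_add mult_ac add.commute)
    finally show "?t (j + m) = \<dots>" .
  qed
  also have "\<dots> = u ^ m * (u + v) ^ (n - m)"
    by (simp add: binomial_ring sum_distrib_left)
  finally show ?thesis unfolding uv by (simp add: u_def)
qed

text \<open>The weights \<open>(x, b\<^sub>n\<^sub>,\<^sub>k(T) x)\<close>, with \<open>b\<^sub>n\<^sub>,\<^sub>k\<close> the Bernstein polynomials, placed at the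
points \<open>M k / n\<close> form probability measures on \<open>[0, M]\<close>, hence a tight sequence. The truncation
of \<open>t\<close> to \<open>[0, M]\<close> makes the integrand bounded, as weak convergence requires; it changes nothing
for the discrete measures, and for the limit it is absorbed later by pushing the measure
forward.\<close>

lemma unit_moment_measure:
  assumes x: "x \<bullet> x = 1"
  obtains \<nu> where "real_distribution \<nu>"
    "\<And>m. (\<integral>t. (max 0 (min M t)) ^ m \<partial>\<nu>) = x \<bullet> poly_op T ([:0, 1:] ^ m) x"
proof -
  define w where "w n k = x \<bullet> poly_op T (bernstein n k) x" for n k
  have w_nonneg: "w n k \<ge> 0" for n k
    by (simp add: w_def bernstein_op_nonneg)
  have w_moment: "(\<Sum>k\<le>n. real (k choose m) / real (n choose m) * w n k)
      = x \<bullet> poly_op T ([:0, 1 / M:] ^ m) x" if "m \<le> n" for m n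
    unfolding bernstein_moment[OF that, symmetric]
    by (simp add: w_def poly_op_simps inner_sum_right)
  have w_sum: "(\<Sum>k\<le>n. w n k) = 1" for n
    using w_moment[of 0 n] x by (simp add: poly_op_simps)
  define \<nu> where "\<nu> n = distr (point_measure {..n} (\<lambda>k. ennreal (w n k))) borel (\<lambda>k. M * (real k /
      real n))" for n
  have meas: "(\<lambda>k. M * (real k / real n)) \<in> measurable (point_measure {..n} (\<lambda>k. ennreal (w n k)))
      borel" for n
    by (simp add: measurable_def space_point_measure sets_point_measure)
  have integral_\<nu>: "integral\<^sup>L (\<nu> n) f = (\<Sum>k\<le>n. w n k * f (M * (real k / real n)))"
    if "f \<in> borel_measurable borel" for n and f :: "real \<Rightarrow> real"
    unfolding \<nu>_def
    by (subst integral_distr[OF meas that])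
      (simp add: lebesgue_integral_point_measure_finite w_nonneg)
  have emeasure_\<nu>: "emeasure (\<nu> n) A = 1" if "A \<in> sets borel" "{0..M} \<subseteq> A" for n A
  proof -
    have "(\<lambda>k. M * (real k / real n)) -` A \<inter> {..n} = {..n}"
      using that M_pos by (auto simp: divide_le_eq intro!: set_mp[OF that(2)])
    then have "emeasure (\<nu> n) A = (\<Sum>k\<le>n. ennreal (w n k))"
      unfolding \<nu>_def using meas that
      by (subst emeasure_distr) (auto simp: emeasure_point_measure_finite space_point_measure)
    also have "\<dots> = 1" by (simp add: sum_ennreal w_nonneg w_sum)
    finally show ?thesis .
  qed
  have rd: "real_distribution (\<nu> n)" for n
    unfolding real_distribution_def real_distribution_axioms_def
    using emeasure_\<nu>[of UNIV n] by (auto intro!: prob_spaceI simp: \<nu>_def)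
  have "tight \<nu>"
    unfolding tight_def
  proof (intro conjI allI impI rd)
    fix e :: real assume "e > 0"
    have "measure (\<nu> n) {-1<..M} = 1" for n
      using emeasure_\<nu>[of "{-1<..M}" n] by (simp add: measure_def subset_eq)
    then show "\<exists>a b. a < b \<and> (\<forall>n. 1 - e < measure (\<nu> n) {a<..b})"
      using \<open>e > 0\<close> M_pos by (intro exI[of _ "-1"] exI[of _ M]) auto
  qed
  then obtain r N where r: "strict_mono (r :: nat \<Rightarrow> nat)" and N: "real_distribution N"
    and weak: "weak_conv_m (\<nu> \<circ> id \<circ> r) N"
    using tight_imp_convergent_subsubsequence[of \<nu> id] by (auto simp: strict_mono_def)
  have "(\<integral>t. (max 0 (min M t)) ^ m \<partial>N) = x \<bullet> poly_op T ([:0, 1:] ^ m) x" for m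
  proof (rule LIMSEQ_unique)
    define f where "f t = (max 0 (min M t)) ^ m" for t
    show "(\<lambda>n. integral\<^sup>L ((\<nu> \<circ> id \<circ> r) n) f) \<longlonglongrightarrow> (\<integral>t. (max 0 (min M t)) ^ m \<partial>N)"
      unfolding f_def
    proof (rule weak_conv_imp_integral_bdd_continuous_conv)
      show "real_distribution ((\<nu> \<circ> id \<circ> r) n)" for n using rd by simp
      show "norm (max 0 (min M t) ^ m) \<le> M ^ m" for t
        using M_pos by (auto intro!: power_mono)
    qed (use N weak in \<open>auto intro!: continuous_intros simp: comp_def\<close>)
    have "x \<bullet> poly_op T ([:0, 1:] ^ m) x = M ^ m * (x \<bullet> poly_op T ([:0, 1 / M:] ^ m) x)"
    proof -
      have "[:0, 1:] = smult M [:0, 1 / M:]" using M_pos by simp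
      then have "[:0, 1:] ^ m = smult (M ^ m) ([:0, 1 / M:] ^ m)" by (simp only: smult_power)
      then show ?thesis by (simp add: poly_op_simps)
    qed
    moreover have "(\<lambda>n. integral\<^sup>L (\<nu> n) f) \<longlonglongrightarrow> M ^ m * (x \<bullet> poly_op T ([:0, 1 / M:] ^ m) x)"
    proof -
      let ?c = "M ^ m * (x \<bullet> poly_op T ([:0, 1 / M:] ^ m) x)"
      have "norm (integral\<^sup>L (\<nu> n) f - ?c) \<le> M ^ m * (real m * (real m / real (n - m)))"
        if "m < n" for n
      proof -
        have f_eq: "f (M * (real k / real n)) = M ^ m * (real k / real n) ^ m" if "k \<le> n" for k
        proof -
          have "M * (real k / real n) \<le> M * 1"
            using that \<open>m < n\<close> M_pos by (intro mult_left_mono) auto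
          moreover have "0 \<le> M * (real k / real n)" using M_pos by simp
          ultimately have "max 0 (min M (M * (real k / real n))) = M * (real k / real n)" by simp
          then show ?thesis by (simp only: f_def power_mult_distrib)
        qed
        have f_meas: "f \<in> borel_measurable borel" unfolding f_def by measurable
        have "integral\<^sup>L (\<nu> n) f - ?c = (\<Sum>k\<le>n. w n k * (M ^ m * (real k / real n) ^ m))
            - M ^ m * (\<Sum>k\<le>n. real (k choose m) / real (n choose m) * w n k)"
          unfolding integral_\<nu>[OF f_meas] w_moment[OF less_imp_le[OF that]]
          by (intro arg_cong2[where f = minus] sum.cong refl) (simp only: f_eq atMost_iff)
        also have "\<dots> = M ^ m * (\<Sum>k\<le>n. w n k * ((real k / real n) ^ m - real (k choose m) / real (n
            choose m)))"
          by (simp add: sum_distrib_left sum_subtractf right_diff_distrib mult_ac)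
        also have "norm \<dots> = M ^ m * \<bar>\<Sum>k\<le>n. w n k * ((real k / real n) ^ m - real (k choose m) / real
            (n choose m))\<bar>"
          using M_pos by (simp add: abs_mult)
        also have "\<dots> \<le> M ^ m * (\<Sum>k\<le>n. w n k * (real m * (real m / real (n - m))))"
        proof (intro mult_left_mono order_trans[OF sum_abs] sum_mono)
          fix k assume "k \<in> {..n}"
          then have "\<bar>(real k / real n) ^ m - real (k choose m) / real (n choose m)\<bar>
              \<le> real m * (real m / real (n - m))"
            using choose_ratio_approx[of k n m] that by (simp only: abs_minus_commute atMost_iff)
          then show "\<bar>w n k * ((real k / real n) ^ m - real (k choose m) / real (n choose m))\<bar>
              \<le> w n k * (real m * (real m / real (n - m)))"
            unfolding abs_mult abs_of_nonneg[OF w_nonneg] by (rule mult_left_mono[OF _ w_nonneg])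
        qed (use M_pos in auto)
        also have "\<dots> = M ^ m * (real m * (real m / real (n - m)))"
          unfolding sum_distrib_right[symmetric] w_sum by simp
        finally show ?thesis .
      qed
      then have "eventually (\<lambda>n. norm (integral\<^sup>L (\<nu> n) f - ?c)
          \<le> M ^ m * (real m * (real m / real (n - m)))) sequentially"
        by (auto simp: eventually_sequentially intro!: exI[of _ "Suc m"])
      moreover have "(\<lambda>n. M ^ m * (real m * (real m / real (n - m)))) \<longlonglongrightarrow> 0"
      proof -
        have "filterlim (\<lambda>n. n - m) at_top sequentially" by (rule filterlim_minus_const_nat_at_top)
        then have "(\<lambda>n. real m / real (n - m)) \<longlonglongrightarrow> 0"
          by (intro tendsto_divide_0[OF tendsto_const] filterlim_at_top_imp_at_infinity
              filterlim_compose[OF filterlim_real_sequentially])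
        from tendsto_mult[OF tendsto_const tendsto_mult[OF tendsto_const this]]
        show ?thesis by (auto intro: tendsto_eq_intros)
      qed
      ultimately have "(\<lambda>n. integral\<^sup>L (\<nu> n) f - ?c) \<longlonglongrightarrow> 0"
        by (rule Lim_null_comparison)
      then show ?thesis by (rule LIM_zero_cancel)
    qed
    ultimately show "(\<lambda>n. integral\<^sup>L ((\<nu> \<circ> id \<circ> r) n) f) \<longlonglongrightarrow> x \<bullet> poly_op T ([:0, 1:] ^ m) x"
      using LIMSEQ_subseq_LIMSEQ[OF _ r] by (fastforce simp: comp_def)
  qed
  with N that show ?thesis by blast
qed

end

section \<open>Polynomials are dense in the square-integrable functions of a compactly supported measure\<close>

lemma integrable_bounded_on_interval:
  fixes f :: "real \<Rightarrow> real"
  assumes "finite_measure \<mu>" "sets \<mu> = sets borel" "AE t in \<mu>. t \<in> {a..b}"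
    and "f \<in> borel_measurable borel" "\<And>t. t \<in> {a..b} \<Longrightarrow> \<bar>f t\<bar> \<le> K"
  shows "integrable \<mu> f"
proof -
  interpret finite_measure \<mu> by fact
  have "f \<in> borel_measurable \<mu>"
    using assms(2,4) measurable_cong_sets[of \<mu> borel borel borel] by simp
  then show ?thesis
    using assms(3,5) by (intro integrable_const_bound[of _ K]) auto
qed

lemma poly_bounded_on_interval:
  fixes p :: "real poly"
  obtains K where "0 \<le> K" "\<And>t. t \<in> {a..b} \<Longrightarrow> \<bar>poly p t\<bar> \<le> K"
proof -
  have "compact (poly p ` {a..b})"
    by (intro compact_continuous_image continuous_intros) simp
  then obtain K where "\<forall>y \<in> poly p ` {a..b}. norm y \<le> K"
    using compact_imp_bounded bounded_iff by metis
  then have "\<bar>poly p t\<bar> \<le> max 0 K" if "t \<in> {a..b}" for t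
    using that by (simp add: le_max_iff_disj)
  then show ?thesis using that[of "max 0 K"] by simp
qed

lemma integral_square_triangle:
  fixes f g h :: "'a \<Rightarrow> real"
  assumes "integrable \<mu> (\<lambda>t. (f t - h t)\<^sup>2)" "integrable \<mu> (\<lambda>t. (f t - g t)\<^sup>2)" "integrable \<mu> (\<lambda>t.
      (g t - h t)\<^sup>2)"
  shows "(\<integral>t. (f t - h t)\<^sup>2 \<partial>\<mu>) \<le> 2 * (\<integral>t. (f t - g t)\<^sup>2 \<partial>\<mu>) + 2 * (\<integral>t. (g t - h t)\<^sup>2 \<partial>\<mu>)"
proof -
  have "(f t - h t)\<^sup>2 \<le> 2 * (f t - g t)\<^sup>2 + 2 * (g t - h t)\<^sup>2" for t
    using sum_squares_bound[of "f t - g t" "g t - h t"] by (simp add: power2_eq_square algebra_simps)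
  then have "(\<integral>t. (f t - h t)\<^sup>2 \<partial>\<mu>) \<le> (\<integral>t. 2 * (f t - g t)\<^sup>2 + 2 * (g t - h t)\<^sup>2 \<partial>\<mu>)"
    using assms by (intro integral_mono) auto
  then show ?thesis using assms by simp
qed

text \<open>An \<open>\<epsilon>\<close>-form of inner regularity, expressed with real-valued measures.\<close>

lemma inner_regular_finite_measure:
  fixes \<mu> :: "'a::{second_countable_topology, complete_space} measure"
  assumes "finite_measure \<mu>" "sets \<mu> = sets borel" "A \<in> sets borel" "0 < e"
  obtains K where "compact K" "K \<subseteq> A" "measure \<mu> (A - K) < e"
proof -
  interpret finite_measure \<mu> by fact
  have "\<exists>K. compact K \<and> K \<subseteq> A \<and> measure \<mu> A - e < measure \<mu> K"
  proof (cases "measure \<mu> A < e")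
    case True
    then show ?thesis by (intro exI[of _ "{}"]) simp
  next
    case False
    have "ennreal (measure \<mu> A - e) < emeasure \<mu> A"
      using False assms(4) by (simp add: emeasure_eq_measure ennreal_less_iff)
    also have "\<dots> = (SUP K \<in> {K. K \<subseteq> A \<and> compact K}. emeasure \<mu> K)"
      using assms emeasure_finite[of "space \<mu>"] by (intro inner_regular) auto
    finally obtain K where "K \<subseteq> A" "compact K" "ennreal (measure \<mu> A - e) < emeasure \<mu> K"
      by (auto simp: less_SUP_iff)
    then show ?thesis
      using False by (auto simp: emeasure_eq_measure ennreal_less_iff)
  qed
  then obtain K where K: "compact K" "K \<subseteq> A" "measure \<mu> A - e < measure \<mu> K" by blast
  then have "measure \<mu> (A - K) < e"
    using assms by (subst finite_measure_Diff) (auto dest: borel_compact)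
  with K that show ?thesis by blast
qed

text \<open>An indicator function is close to that of a compact set \<open>D\<close> by inner regularity, that one
to a continuous function of the distance to \<open>D\<close> by dominated convergence, and the latter to a
polynomial by the Weierstrass theorem. One polynomial serves finitely many measures because
finite unions of compact sets are compact.\<close>

lemma poly_approx_indicator:
  fixes \<mu> :: "'i \<Rightarrow> real measure"
  assumes "finite I"
    and fin: "\<And>i. i \<in> I \<Longrightarrow> finite_measure (\<mu> i)"
    and sets: "\<And>i. i \<in> I \<Longrightarrow> sets (\<mu> i) = sets borel"
    and supp: "\<And>i. i \<in> I \<Longrightarrow> AE t in \<mu> i. t \<in> {a..b}"
    and A: "A \<in> sets borel" and "0 < e"
  obtains p :: "real poly" where "\<And>i. i \<in> I \<Longrightarrow> (\<integral>t. (poly p t - indicator A t)\<^sup>2 \<partial>\<mu> i) < e"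
proof -
  have int: "integrable (\<mu> i) (\<lambda>t. (f t - g t)\<^sup>2)"
    if "i \<in> I" "f \<in> borel_measurable borel" "g \<in> borel_measurable borel"
      "\<And>t. t \<in> {a..b} \<Longrightarrow> \<bar>f t\<bar> \<le> K" "\<And>t. t \<in> {a..b} \<Longrightarrow> \<bar>g t\<bar> \<le> L"
    for i and f g :: "real \<Rightarrow> real" and K L
  proof (rule integrable_bounded_on_interval)
    show "finite_measure (\<mu> i)" "sets (\<mu> i) = sets borel" "AE t in \<mu> i. t \<in> {a..b}"
      using that(1) by (rule fin sets supp)+
    show "\<bar>(f t - g t)\<^sup>2\<bar> \<le> (K + L)\<^sup>2" if "t \<in> {a..b}" for t
    proof -
      have "\<bar>f t - g t\<bar> \<le> K + L" using \<open>t \<in> {a..b}\<close> \<open>\<And>t. t \<in> {a..b} \<Longrightarrow> \<bar>f t\<bar> \<le> K\<close>[of t]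
        \<open>\<And>t. t \<in> {a..b} \<Longrightarrow> \<bar>g t\<bar> \<le> L\<close>[of t] by linarith
      then show ?thesis by (metis abs_ge_zero abs_power2 power2_abs power_mono)
    qed
    show "(\<lambda>t. (f t - g t)\<^sup>2) \<in> borel_measurable borel" using that by simp
  qed
  have "\<exists>C. compact C \<and> C \<subseteq> A \<and> measure (\<mu> i) (A - C) < e / 16" if "i \<in> I" for i
    using inner_regular_finite_measure[OF fin[OF that] sets[OF that] A, of "e / 16"] \<open>0 < e\<close> by force
  then obtain C where C: "\<And>i. i \<in> I \<Longrightarrow> compact (C i) \<and> C i \<subseteq> A \<and> measure (\<mu> i) (A - C i) < e / 16"
    by metis
  define D where "D = (\<Union>i\<in>I. C i)"
  have D: "compact D" "D \<subseteq> A"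
    using C \<open>finite I\<close> by (auto simp: D_def intro!: compact_UN)
  then have D_borel: "D \<in> sets borel" by (simp add: borel_compact)
  have step1: "(\<integral>t. (indicator D t - indicator A t)\<^sup>2 \<partial>\<mu> i) < e / 16" if i: "i \<in> I" for i
  proof -
    interpret finite_measure "\<mu> i" using fin i by simp
    have "(\<lambda>t. (indicator D t - indicator A t :: real)\<^sup>2) = indicator (A - D)"
      using D by (auto simp: indicator_def fun_eq_iff)
    then have "(\<integral>t. (indicator D t - indicator A t)\<^sup>2 \<partial>\<mu> i) = measure (\<mu> i) (A - D)"
      using A D_borel sets[OF i] by simp
    also have "\<dots> \<le> measure (\<mu> i) (A - C i)"
      using i A C[OF i] sets[OF i] by (intro finite_measure_mono) (auto simp: D_def borel_compact)
    finally show ?thesis using C[OF i] by simp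
  qed
  define g :: "nat \<Rightarrow> real \<Rightarrow> real"
    where "g n t = (if D = {} then 0 else max 0 (1 - real n * infdist t D))" for n t
  have g_cont: "continuous_on UNIV (g n)" for n
    unfolding g_def by (cases "D = {}") (auto intro!: continuous_intros)
  then have g_meas: "g n \<in> borel_measurable borel" for n
    by (rule borel_measurable_continuous_onI)
  have g_bound: "\<bar>g n t\<bar> \<le> 1" for n t
    by (auto simp: g_def infdist_nonneg)
  have g_lim: "(\<lambda>n. g n t) \<longlonglongrightarrow> indicator D t" for t
  proof (cases "t \<in> D")
    case True
    then have "g n t = 1" for n by (auto simp: g_def)
    then show ?thesis using True by simp
  next
    case False
    show ?thesis
    proof (cases "D = {}")
      case nonempty: False
      have pos: "infdist t D > 0"
        using False nonempty D by (intro infdist_pos_not_in_closed compact_imp_closed)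
      then obtain N where N: "1 < real N * infdist t D"
        using reals_Archimedean3 by blast
      have "g n t = 0" if "n \<ge> N" for n
      proof -
        have "real N * infdist t D \<le> real n * infdist t D"
          using that pos by (intro mult_right_mono) auto
        then show ?thesis using N by (simp add: g_def)
      qed
      then have "eventually (\<lambda>n. g n t = 0) sequentially"
        by (auto simp: eventually_sequentially)
      then show ?thesis using False by (simp add: tendsto_eventually)
    qed (simp add: g_def)
  qed
  have step2: "\<exists>n. \<forall>i\<in>I. (\<integral>t. (g n t - indicator D t)\<^sup>2 \<partial>\<mu> i) < e / 16"
  proof -
    have lim: "(\<lambda>n. \<integral>t. (g n t - indicator D t)\<^sup>2 \<partial>\<mu> i) \<longlonglongrightarrow> 0" if i: "i \<in> I" for i
    proof -
      interpret finite_measure "\<mu> i" using fin i by simp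
      have "(\<lambda>n. \<integral>t. (g n t - indicator D t)\<^sup>2 \<partial>\<mu> i) \<longlonglongrightarrow> (\<integral>t. 0 \<partial>\<mu> i)"
      proof (rule integral_dominated_convergence[where w = "\<lambda>_. 4"])
        show "AE t in \<mu> i. (\<lambda>n. (g n t - indicator D t)\<^sup>2) \<longlonglongrightarrow> 0"
        proof (rule AE_I2)
          fix t
          have "(\<lambda>n. (g n t - indicator D t)\<^sup>2) \<longlonglongrightarrow> (indicator D t - indicator D t)\<^sup>2"
            by (intro tendsto_intros g_lim)
          then show "(\<lambda>n. (g n t - indicator D t)\<^sup>2) \<longlonglongrightarrow> 0" by simp
        qed
        show "AE t in \<mu> i. norm ((g n t - indicator D t)\<^sup>2) \<le> 4" for n
        proof (rule AE_I2)
          fix t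
          have "\<bar>g n t - indicator D t\<bar> \<le> 2" using g_bound[of n t] by (auto simp: indicator_def)
          from power_mono[OF this, of 2] show "norm ((g n t - indicator D t)\<^sup>2) \<le> 4" by simp
        qed
        have cong: "borel_measurable (\<mu> i) = (borel_measurable borel :: (real \<Rightarrow> real) set)"
          using sets[OF i] by (rule measurable_cong_sets) simp
        show "(\<lambda>t. (g n t - indicator D t)\<^sup>2) \<in> borel_measurable (\<mu> i)" for n
          unfolding cong using g_meas D_borel by simp
      qed auto
      then show ?thesis by simp
    qed
    have "eventually (\<lambda>n. (\<integral>t. (g n t - indicator D t)\<^sup>2 \<partial>\<mu> i) < e / 16) sequentially" if "i \<in> I" for i
      using order_tendstoD(2)[OF lim[OF that], of "e / 16"] \<open>0 < e\<close> by simp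
    then have "eventually (\<lambda>n. \<forall>i\<in>I. (\<integral>t. (g n t - indicator D t)\<^sup>2 \<partial>\<mu> i) < e / 16) sequentially"
      using \<open>finite I\<close> by (simp add: eventually_ball_finite)
    then show ?thesis unfolding eventually_sequentially by blast
  qed
  then obtain n where n: "\<And>i. i \<in> I \<Longrightarrow> (\<integral>t. (g n t - indicator D t)\<^sup>2 \<partial>\<mu> i) < e / 16" by blast
  define m where "m = (\<Sum>i\<in>I. measure (\<mu> i) UNIV) + 1"
  have m: "measure (\<mu> i) UNIV < m" "0 < m" if "i \<in> I" for i
    using member_le_sum[OF that, of "\<lambda>i. measure (\<mu> i) UNIV"] \<open>finite I\<close>
    using sum_nonneg[of I "\<lambda>i. measure (\<mu> i) UNIV"] by (auto simp: m_def)
  \<comment> \<open>Uniform accuracy \<open>d\<close> costs at most \<open>d\<^sup>2 m = e / 4\<close>, since every mass is below \<open>m\<close>.\<close>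
  define d where "d = (if I = {} then 1 else sqrt (e / (4 * m)))"
  have d: "0 < d" using m \<open>0 < e\<close> by (auto simp: d_def)
  have "\<exists>q. (\<exists>p :: real poly. q = poly p) \<and> (\<forall>t\<in>{a..b}. \<bar>g n t - q t\<bar> < d)"
  proof (rule Stone_Weierstrass_HOL)
    show "\<exists>p :: real poly. (\<lambda>x. c) = poly p" for c
      by (rule exI[of _ "[:c:]"]) auto
    show "\<exists>p. (\<lambda>x. f x + h x) = poly p"
      if fh: "(\<exists>p :: real poly. f = poly p) \<and> (\<exists>p. h = poly p)" for f h
    proof -
      obtain p q where "f = poly p" "h = poly q" using fh by blast
      then have "(\<lambda>x. f x + h x) = poly (p + q)" by (simp add: fun_eq_iff)
      then show ?thesis by blast
    qed
    show "\<exists>p. (\<lambda>x. f x * h x) = poly p"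
      if fh: "(\<exists>p :: real poly. f = poly p) \<and> (\<exists>p. h = poly p)" for f h
    proof -
      obtain p q where "f = poly p" "h = poly q" using fh by blast
      then have "(\<lambda>x. f x * h x) = poly (p * q)" by (simp add: fun_eq_iff)
      then show ?thesis by blast
    qed
    show "\<exists>f. (\<exists>p :: real poly. f = poly p) \<and> f x \<noteq> f y" if "x \<in> {a..b} \<and> y \<in> {a..b} \<and> x \<noteq> y" for x y
      using that by (intro exI[of _ "poly [:0, 1:]"]) auto
    show "continuous_on {a..b} (g n)" using g_cont continuous_on_subset by blast
  qed (use d in \<open>auto intro!: continuous_intros\<close>)
  then obtain p :: "real poly" where p: "\<And>t. t \<in> {a..b} \<Longrightarrow> \<bar>poly p t - g n t\<bar> < d"
    by (metis abs_minus_commute)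
  obtain K where K: "\<And>t. t \<in> {a..b} \<Longrightarrow> \<bar>poly p t\<bar> \<le> K"
    using poly_bounded_on_interval[of a b p] by blast
  have p_meas: "poly p \<in> borel_measurable borel"
    by (intro borel_measurable_continuous_onI continuous_intros)
  have ind: "\<bar>indicator B t :: real\<bar> \<le> 1" for B :: "real set" and t by (simp add: indicator_def)
  have "(\<integral>t. (poly p t - indicator A t)\<^sup>2 \<partial>\<mu> i) < e" if i: "i \<in> I" for i
  proof -
    interpret finite_measure "\<mu> i" using fin i by simp
    have space: "space (\<mu> i) = UNIV" using sets_eq_imp_space_eq[OF sets[OF i]] by simp
    have "(\<integral>t. (poly p t - g n t)\<^sup>2 \<partial>\<mu> i) \<le> (\<integral>t. d\<^sup>2 \<partial>\<mu> i)"
    proof (rule integral_mono_AE)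
      show "AE t in \<mu> i. (poly p t - g n t)\<^sup>2 \<le> d\<^sup>2"
        using supp[OF i] by eventually_elim (use p d in \<open>simp add: abs_le_square_iff[symmetric]
            less_imp_le\<close>)
    qed (use int[OF i p_meas g_meas K g_bound] in auto)
    also have "\<dots> = e / (4 * m) * measure (\<mu> i) UNIV"
      using \<open>i \<in> I\<close> m[OF i] \<open>0 < e\<close> by (auto simp: d_def space)
    also have "\<dots> < e / (4 * m) * m"
      using m[OF i] \<open>0 < e\<close> by (intro mult_strict_left_mono) auto
    also have "\<dots> = e / 4" using m[OF i] by simp
    finally have 1: "(\<integral>t. (poly p t - g n t)\<^sup>2 \<partial>\<mu> i) < e / 4" .
    have 2: "(\<integral>t. (g n t - indicator A t)\<^sup>2 \<partial>\<mu> i)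
        \<le> 2 * (\<integral>t. (g n t - indicator D t)\<^sup>2 \<partial>\<mu> i) + 2 * (\<integral>t. (indicator D t - indicator A t)\<^sup>2 \<partial>\<mu> i)"
      using A D_borel by (intro integral_square_triangle int[OF i _ _ g_bound ind] int[OF i _ _ ind
          ind] g_meas) auto
    have 3: "(\<integral>t. (poly p t - indicator A t)\<^sup>2 \<partial>\<mu> i)
        \<le> 2 * (\<integral>t. (poly p t - g n t)\<^sup>2 \<partial>\<mu> i) + 2 * (\<integral>t. (g n t - indicator A t)\<^sup>2 \<partial>\<mu> i)"
      using A by (intro integral_square_triangle int[OF i _ _ K g_bound] int[OF i _ _ g_bound ind]
          int[OF i _ _ K ind] g_meas p_meas) auto
    show ?thesis using 1 2 3 step1[OF i] n[OF i] by linarith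
  qed
  then show ?thesis using that by blast
qed

section \<open>The spectral theorem for positive operators\<close>

text \<open>The Cauchy-Schwarz inequality against the constant function. The added \<open>1\<close> only avoids
dividing by zero for the null measure; the bound is used to pass to limits.\<close>

lemma integral_square_bound:
  fixes u :: "'a \<Rightarrow> real"
  assumes "finite_measure \<mu>" "integrable \<mu> u" "integrable \<mu> (\<lambda>t. (u t)\<^sup>2)"
  shows "(\<integral>t. u t \<partial>\<mu>)\<^sup>2 \<le> (measure \<mu> (space \<mu>) + 1) * (\<integral>t. (u t)\<^sup>2 \<partial>\<mu>)"
proof -
  interpret finite_measure \<mu> by fact
  define m where "m = measure \<mu> (space \<mu>)"
  define I where "I = (\<integral>t. u t \<partial>\<mu>)"
  define c where "c = I / (m + 1)"
  have m: "0 \<le> m" by (simp add: m_def)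
  have I: "I = c * (m + 1)" using m by (simp add: c_def)
  have "0 \<le> (\<integral>t. (u t - c)\<^sup>2 \<partial>\<mu>)" by simp
  also have "\<dots> = (\<integral>t. (u t)\<^sup>2 - 2 * c * u t + c\<^sup>2 \<partial>\<mu>)"
    by (simp add: power2_diff algebra_simps)
  also have "\<dots> = (\<integral>t. (u t)\<^sup>2 \<partial>\<mu>) - 2 * c * I + c\<^sup>2 * m"
    using assms by (simp add: I_def m_def)
  finally have "c\<^sup>2 * m + 2 * c\<^sup>2 \<le> (\<integral>t. (u t)\<^sup>2 \<partial>\<mu>)"
    by (simp add: I power2_eq_square algebra_simps)
  moreover have "0 \<le> c\<^sup>2" by simp
  ultimately have "c\<^sup>2 * (m + 1) \<le> (\<integral>t. (u t)\<^sup>2 \<partial>\<mu>)" unfolding distrib_left by linarith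
  then have "(m + 1) * (c\<^sup>2 * (m + 1)) \<le> (m + 1) * (\<integral>t. (u t)\<^sup>2 \<partial>\<mu>)"
    using m by (intro mult_left_mono) auto
  then show ?thesis by (simp add: I_def[symmetric] m_def[symmetric] I power2_eq_square mult_ac)
qed

lemma tendsto_integral_of_square:
  fixes u :: "nat \<Rightarrow> 'a \<Rightarrow> real"
  assumes "finite_measure \<mu>" "\<And>n. integrable \<mu> (u n)" "\<And>n. integrable \<mu> (\<lambda>t. (u n t)\<^sup>2)"
    and lim: "(\<lambda>n. \<integral>t. (u n t)\<^sup>2 \<partial>\<mu>) \<longlonglongrightarrow> 0"
  shows "(\<lambda>n. \<integral>t. u n t \<partial>\<mu>) \<longlonglongrightarrow> 0"
proof -
  have "(\<lambda>n. (\<integral>t. u n t \<partial>\<mu>)\<^sup>2) \<longlonglongrightarrow> 0"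
  proof (rule Lim_null_comparison)
    show "eventually (\<lambda>n. norm ((\<integral>t. u n t \<partial>\<mu>)\<^sup>2)
        \<le> (measure \<mu> (space \<mu>) + 1) * (\<integral>t. (u n t)\<^sup>2 \<partial>\<mu>)) sequentially"
      using integral_square_bound[OF assms(1-3)] by simp
    show "(\<lambda>n. (measure \<mu> (space \<mu>) + 1) * (\<integral>t. (u n t)\<^sup>2 \<partial>\<mu>)) \<longlonglongrightarrow> 0"
      using tendsto_mult_left[OF lim] by simp
  qed
  then show ?thesis by (simp add: power_tendsto_0_iff)
qed

context positive_operator
begin

definition is_moment_measure :: "'h \<Rightarrow> real measure \<Rightarrow> bool" where
  "is_moment_measure x \<mu> \<longleftrightarrow> finite_measure \<mu> \<and> sets \<mu> = sets borel \<and> (AE t in \<mu>. t \<in> {0..M}) \<and>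
     (\<forall>p. (\<integral>t. poly p t \<partial>\<mu>) = x \<bullet> poly_op T p x)"

text \<open>Pushing the weak limit forward along the truncation to \<open>[0, M]\<close> confines it to the
interval, so that the truncated moments become moments. The factor \<open>\<parallel>x\<parallel>\<^sup>2\<close> undoes the
normalisation of \<open>x\<close>.\<close>

lemma ex_moment_measure: "\<exists>\<mu>. is_moment_measure x \<mu>"
proof -
  define c where "c t = max 0 (min M t)" for t
  have c_meas: "c \<in> borel_measurable borel" unfolding c_def by measurable
  obtain \<nu> where \<nu>: "real_distribution \<nu>"
    and mom: "\<And>m. (norm x)\<^sup>2 * (\<integral>t. c t ^ m \<partial>\<nu>) = x \<bullet> poly_op T ([:0, 1:] ^ m) x"
  proof (cases "x = 0")
    case True
    have "real_distribution (return borel 0)"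
      unfolding real_distribution_def real_distribution_axioms_def
      by (auto intro!: prob_spaceI)
    then show ?thesis using that[of "return borel 0"] True by simp
  next
    case False
    define y where "y = (1 / norm x) *\<^sub>R x"
    have y: "y \<bullet> y = 1" using False by (simp add: y_def dot_square_norm)
    obtain \<nu> where \<nu>: "real_distribution \<nu>"
      "\<And>m. (\<integral>t. c t ^ m \<partial>\<nu>) = y \<bullet> poly_op T ([:0, 1:] ^ m) y"
      using unit_moment_measure[OF y] unfolding c_def by metis
    have "(norm x)\<^sup>2 * (y \<bullet> poly_op T p y) = x \<bullet> poly_op T p x" for p
      using False linear_scale[OF linear_poly_op[OF linear]] by (simp add: y_def power2_eq_square)
    then show ?thesis using that[OF \<nu>(1)] by (simp add: \<nu>(2))
  qed
  interpret real_distribution \<nu> by fact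
  define \<mu> where "\<mu> = density (distr \<nu> borel c) (\<lambda>_. ennreal ((norm x)\<^sup>2))"
  have sets: "sets \<mu> = sets borel" by (simp add: \<mu>_def)
  have c_meas': "c \<in> measurable \<nu> borel" using c_meas by simp
  have "emeasure \<mu> (space \<mu>) = ennreal ((norm x)\<^sup>2) * emeasure \<nu> (space \<nu>)"
    using c_meas' by (simp add: \<mu>_def emeasure_density nn_integral_cmult emeasure_distr)
  then have fin: "finite_measure \<mu>"
    by (intro finite_measureI) (simp add: emeasure_space_1[simplified] ennreal_mult_eq_top_iff)
  have supp: "AE t in \<mu>. t \<in> {0..M}"
  proof -
    have "AE t in distr \<nu> borel c. t \<in> {0..M}"
      using c_meas' M_pos by (subst AE_distr_iff) (auto simp: c_def)
    then show ?thesis unfolding \<mu>_def by (subst AE_density) auto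
  qed
  have int: "integrable \<nu> (\<lambda>t. c t ^ m)" for m
    using c_meas' M_pos by (intro integrable_const_bound[of _ "M ^ m"]) (auto simp: c_def intro!:
        power_mono)
  have "(\<integral>t. poly p t \<partial>\<mu>) = x \<bullet> poly_op T p x" for p
  proof -
    have meas: "poly p \<in> borel_measurable borel"
      by (intro borel_measurable_continuous_onI continuous_intros)
    have "(\<integral>t. poly p t \<partial>\<mu>) = (norm x)\<^sup>2 * (\<integral>t. poly p (c t) \<partial>\<nu>)"
      using meas c_meas' by (simp add: \<mu>_def integral_density integral_distr)
    also have "\<dots> = (\<Sum>i\<le>degree p. coeff p i * ((norm x)\<^sup>2 * (\<integral>t. c t ^ i \<partial>\<nu>)))"
      by (simp add: poly_altdef int sum_distrib_left mult_ac)
    also have "\<dots> = x \<bullet> poly_op T (\<Sum>i\<le>degree p. smult (coeff p i) ([:0, 1:] ^ i)) x"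
      by (simp add: mom poly_op_simps inner_sum_right)
    also have "(\<Sum>i\<le>degree p. smult (coeff p i) ([:0, 1:] ^ i)) = p"
      using poly_as_sum_of_monoms[of p] by (simp add: monom_altdef)
    finally show ?thesis .
  qed
  with fin sets supp show ?thesis unfolding is_moment_measure_def by blast
qed

definition moment_measure :: "'h \<Rightarrow> real measure" where
  "moment_measure x = (SOME \<mu>. is_moment_measure x \<mu>)"

lemma moment_measure: "is_moment_measure x (moment_measure x)"
  unfolding moment_measure_def by (rule someI_ex[OF ex_moment_measure])

lemma finite_moment_measure: "finite_measure (moment_measure x)"
  and sets_moment_measure [simp]: "sets (moment_measure x) = sets borel"
  and AE_moment_measure: "AE t in moment_measure x. t \<in> {0..M}"
  and integral_poly: "(\<integral>t. poly p t \<partial>moment_measure x) = x \<bullet> poly_op T p x"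
  using moment_measure[of x] by (simp_all add: is_moment_measure_def)

lemma space_moment_measure [simp]: "space (moment_measure x) = UNIV"
  using sets_eq_imp_space_eq[OF sets_moment_measure[of x]] by simp

text \<open>The map \<open>p \<mapsto> p(T) x\<close> is an isometry from the polynomials with the norm of \<open>L\<^sup>2(\<mu>\<^sub>x)\<close> to the
Hilbert space. Everything about the spectral projections comes from this.\<close>

lemma norm_poly_op: "(norm (poly_op T p x))\<^sup>2 = (\<integral>t. (poly p t)\<^sup>2 \<partial>moment_measure x)"
proof -
  have "(norm (poly_op T p x))\<^sup>2 = x \<bullet> poly_op T (p * p) x"
    by (simp add: power2_norm_eq_inner inner_poly_op[OF linear symmetric] poly_op_mult[OF linear])
  then show ?thesis by (simp flip: integral_poly add: power2_eq_square)
qed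

lemma integrable_moment_measure:
  fixes f :: "real \<Rightarrow> real"
  assumes "f \<in> borel_measurable borel" "\<And>t. t \<in> {0..M} \<Longrightarrow> \<bar>f t\<bar> \<le> K"
  shows "integrable (moment_measure x) f"
  by (rule integrable_bounded_on_interval[OF finite_moment_measure sets_moment_measure
      AE_moment_measure assms])

lemma integrable_poly_indicator:
  assumes "A \<in> sets borel"
  shows "integrable (moment_measure x) (poly p)"
    and "integrable (moment_measure x) (\<lambda>t. poly p t - indicator A t)"
    and "integrable (moment_measure x) (\<lambda>t. (poly p t - indicator A t)\<^sup>2)"
    and "integrable (moment_measure x) (\<lambda>t. (poly p t - indicator A t) * indicator A t)"
    and "integrable (moment_measure x) (\<lambda>t. ((poly p t - indicator A t) * indicator A t)\<^sup>2)"
    and "integrable (moment_measure x) (\<lambda>t. (poly p t - poly q t)\<^sup>2)"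
proof -
  have meas: "poly p \<in> borel_measurable borel" for p :: "real poly"
    by (intro borel_measurable_continuous_onI continuous_intros)
  obtain K where "0 \<le> K" and K: "\<And>t. t \<in> {0..M} \<Longrightarrow> \<bar>poly p t\<bar> \<le> K"
    using poly_bounded_on_interval[of 0 M p] by blast
  have d: "\<bar>poly p t - indicator A t\<bar> \<le> K + 1" if "t \<in> {0..M}" for t
    using K[OF that] by (auto simp: indicator_def abs_le_iff)
  have d2: "\<bar>(poly p t - indicator A t) * indicator A t\<bar> \<le> K + 1" if "t \<in> {0..M}" for t
    using d[OF that] \<open>0 \<le> K\<close> by (auto simp: indicator_def)
  have sq: "\<bar>z\<^sup>2\<bar> \<le> L\<^sup>2" if "\<bar>z\<bar> \<le> L" for z L :: real
    using power_mono[OF that, of 2] by simp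
  show "integrable (moment_measure x) (poly p)"
    by (rule integrable_moment_measure[OF meas K])
  show "integrable (moment_measure x) (\<lambda>t. poly p t - indicator A t)"
    using assms meas by (intro integrable_moment_measure[OF _ d]) auto
  show "integrable (moment_measure x) (\<lambda>t. (poly p t - indicator A t)\<^sup>2)"
    using assms meas by (intro integrable_moment_measure[OF _ sq[OF d]]) auto
  show "integrable (moment_measure x) (\<lambda>t. (poly p t - indicator A t) * indicator A t)"
    using assms meas by (intro integrable_moment_measure[OF _ d2]) auto
  show "integrable (moment_measure x) (\<lambda>t. ((poly p t - indicator A t) * indicator A t)\<^sup>2)"
    using assms meas by (intro integrable_moment_measure[OF _ sq[OF d2]]) auto
  obtain L where L: "\<And>t. t \<in> {0..M} \<Longrightarrow> \<bar>poly ((p - q) * (p - q)) t\<bar> \<le> L"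
    using poly_bounded_on_interval[of 0 M "(p - q) * (p - q)"] by blast
  show "integrable (moment_measure x) (\<lambda>t. (poly p t - poly q t)\<^sup>2)"
    using integrable_moment_measure[OF meas L, of x] by (simp add: power2_eq_square)
qed

abbreviation L2_error :: "'h \<Rightarrow> real poly \<Rightarrow> real set \<Rightarrow> real" where
  "L2_error x p A \<equiv> (\<integral>t. (poly p t - indicator A t)\<^sup>2 \<partial>moment_measure x)"

text \<open>Finitely many vectors share one approximating sequence; comparing \<open>E(A)\<close> at different
vectors depends on that.\<close>

lemma ex_poly_sequence:
  assumes "finite X" "A \<in> sets borel"
  obtains p where "\<And>x. x \<in> X \<Longrightarrow> (\<lambda>n. L2_error x (p n) A) \<longlonglongrightarrow> 0"
proof -
  have "\<exists>p. \<forall>x\<in>X. L2_error x p A < inverse (real (Suc n))" for n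
    using poly_approx_indicator[of X moment_measure 0 M A "inverse (real (Suc n))"]
      assms finite_moment_measure AE_moment_measure
          by (metis sets_moment_measure inverse_positive_iff_positive of_nat_0_less_iff zero_less_Suc)
  then obtain p where p: "\<And>n x. x \<in> X \<Longrightarrow> L2_error x (p n) A < inverse (real (Suc n))" by metis
  have "(\<lambda>n. L2_error x (p n) A) \<longlonglongrightarrow> 0" if "x \<in> X" for x
    using p[OF that] by (intro Lim_null_comparison[OF _ LIMSEQ_inverse_real_of_nat])
      (auto intro!: always_eventually less_imp_le)
  with that show ?thesis by blast
qed

lemma norm_poly_op_diff_le:
  assumes "A \<in> sets borel"
  shows "(norm (poly_op T p x - poly_op T q x))\<^sup>2 \<le> 2 * L2_error x p A + 2 * L2_error x q A"
proof -
  have "(norm (poly_op T p x - poly_op T q x))\<^sup>2 = (\<integral>t. (poly p t - poly q t)\<^sup>2 \<partial>moment_measure x)"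
    using norm_poly_op[of "p - q" x] by (simp add: poly_op_simps)
  also have "\<dots> \<le> 2 * L2_error x p A + 2 * (\<integral>t. (indicator A t - poly q t)\<^sup>2 \<partial>moment_measure x)"
    using integrable_poly_indicator[OF assms]
    by (intro integral_square_triangle) (simp_all add: power2_commute[of "indicator A _"])
  finally show ?thesis by (simp add: power2_commute[of "indicator A _"])
qed

text \<open>The vector \<open>v\<close> is the image of the indicator function of \<open>A\<close> under the isometry \<open>p \<mapsto> p(T)
x\<close>, extended by continuity. The defining inequality says that \<open>v\<close> is the limit of \<open>p\<^sub>n(T) x\<close>
whenever \<open>p\<^sub>n\<close> tends to this indicator function. The true isometry has the constant \<open>1\<close>; with
\<open>2\<close>, existence of \<open>v\<close> needs only the elementary inequality for the square of a sum.\<close>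

definition spectral_proj :: "real set \<Rightarrow> 'h \<Rightarrow> 'h" where
  "spectral_proj A x = (SOME v. \<forall>p. (norm (poly_op T p x - v))\<^sup>2 \<le> 2 * L2_error x p A)"

lemma spectral_proj_error:
  assumes A: "A \<in> sets borel"
  shows "(norm (poly_op T p x - spectral_proj A x))\<^sup>2 \<le> 2 * L2_error x p A"
proof -
  obtain q where q: "(\<lambda>n. L2_error x (q n) A) \<longlonglongrightarrow> 0"
    using ex_poly_sequence[of "{x}" A] A by auto
  define v where "v n = poly_op T (q n) x" for n
  have "Cauchy v"
  proof (rule metric_CauchyI)
    fix e :: real assume e: "e > 0"
    then have "eventually (\<lambda>n. L2_error x (q n) A < e\<^sup>2 / 4) sequentially"
      by (intro order_tendstoD(2)[OF q]) auto
    then obtain N where N: "\<And>n. n \<ge> N \<Longrightarrow> L2_error x (q n) A < e\<^sup>2 / 4"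
      by (auto simp: eventually_sequentially)
    have "dist (v i) (v j) < e" if "i \<ge> N" "j \<ge> N" for i j
    proof -
      have "(norm (v i - v j))\<^sup>2 < e\<^sup>2"
        using norm_poly_op_diff_le[OF A, of "q i" x "q j"] N[OF that(1)] N[OF that(2)]
        unfolding v_def by argo
      then show ?thesis
        using e by (simp add: dist_norm power2_less_imp_less)
    qed
    then show "\<exists>N. \<forall>i\<ge>N. \<forall>j\<ge>N. dist (v i) (v j) < e" by blast
  qed
  then obtain w where w: "v \<longlonglongrightarrow> w" using Cauchy_convergent convergent_def by blast
  have w_error: "(norm (poly_op T p x - w))\<^sup>2 \<le> 2 * L2_error x p A" for p
  proof (rule LIMSEQ_le)
    show "(\<lambda>n. (norm (poly_op T p x - v n))\<^sup>2) \<longlonglongrightarrow> (norm (poly_op T p x - w))\<^sup>2"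
      by (intro tendsto_intros w)
    have "(\<lambda>n. 2 * L2_error x p A + 2 * L2_error x (q n) A) \<longlonglongrightarrow> 2 * L2_error x p A + 2 * 0"
      by (intro tendsto_intros q)
    then show "(\<lambda>n. 2 * L2_error x p A + 2 * L2_error x (q n) A) \<longlonglongrightarrow> 2 * L2_error x p A" by simp
    show "\<exists>N. \<forall>n\<ge>N. (norm (poly_op T p x - v n))\<^sup>2 \<le> 2 * L2_error x p A + 2 * L2_error x (q n) A"
      using norm_poly_op_diff_le[OF A] by (auto simp: v_def)
  qed
  have "\<exists>v. \<forall>p. (norm (poly_op T p x - v))\<^sup>2 \<le> 2 * L2_error x p A"
    using w_error by blast
  from someI_ex[OF this] show ?thesis unfolding spectral_proj_def by blast
qed

lemma tendsto_spectral_proj: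
  assumes A: "A \<in> sets borel" and lim: "(\<lambda>n. L2_error x (p n) A) \<longlonglongrightarrow> 0"
  shows "(\<lambda>n. poly_op T (p n) x) \<longlonglongrightarrow> spectral_proj A x"
proof -
  have "(\<lambda>n. (norm (poly_op T (p n) x - spectral_proj A x))\<^sup>2) \<longlonglongrightarrow> 0"
  proof (rule Lim_null_comparison)
    show "eventually (\<lambda>n. norm ((norm (poly_op T (p n) x - spectral_proj A x))\<^sup>2)
        \<le> 2 * L2_error x (p n) A) sequentially"
      using spectral_proj_error[OF A] by simp
    show "(\<lambda>n. 2 * L2_error x (p n) A) \<longlonglongrightarrow> 0"
      using tendsto_mult_left[OF lim, of 2] by simp
  qed
  then have "(\<lambda>n. norm (poly_op T (p n) x - spectral_proj A x)) \<longlonglongrightarrow> 0"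
    by (simp add: power_tendsto_0_iff)
  then show ?thesis by (simp add: tendsto_norm_zero_iff LIM_zero_iff)
qed

lemma spectral_proj_approx:
  assumes "finite X" "A \<in> sets borel"
  shows "\<exists>p. \<forall>x\<in>X. (\<lambda>n. L2_error x (p n) A) \<longlonglongrightarrow> 0 \<and>
    (\<lambda>n. poly_op T (p n) x) \<longlonglongrightarrow> spectral_proj A x"
proof -
  obtain p where "\<And>x. x \<in> X \<Longrightarrow> (\<lambda>n. L2_error x (p n) A) \<longlonglongrightarrow> 0"
    using ex_poly_sequence[OF assms] by blast
  then show ?thesis using tendsto_spectral_proj[OF assms(2)] by blast
qed

lemma linear_spectral_proj:
  assumes A: "A \<in> sets borel"
  shows "linear (spectral_proj A)"
proof (rule linearI)
  fix x y :: 'h and c :: real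
  have fin: "finite {x, y, x + y, c *\<^sub>R x}" by simp
  obtain p where "\<forall>z\<in>{x, y, x + y, c *\<^sub>R x}. (\<lambda>n. L2_error z (p n) A) \<longlonglongrightarrow> 0 \<and>
      (\<lambda>n. poly_op T (p n) z) \<longlonglongrightarrow> spectral_proj A z"
    using spectral_proj_approx[OF fin A] by (rule exE)
  then have p: "(\<lambda>n. poly_op T (p n) z) \<longlonglongrightarrow> spectral_proj A z" if "z \<in> {x, y, x + y, c *\<^sub>R x}" for z
    using that by (simp only:)
  have "(\<lambda>n. poly_op T (p n) (x + y)) \<longlonglongrightarrow> spectral_proj A x + spectral_proj A y"
    using tendsto_add[OF p[of x] p[of y]] by (simp add: linear_add[OF linear_poly_op[OF linear]])
  then show "spectral_proj A (x + y) = spectral_proj A x + spectral_proj A y"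
    using p[of "x + y"] LIMSEQ_unique by blast
  have "(\<lambda>n. poly_op T (p n) (c *\<^sub>R x)) \<longlonglongrightarrow> c *\<^sub>R spectral_proj A x"
    using tendsto_scaleR[OF tendsto_const p[of x]]
        by (simp add: linear_scale[OF linear_poly_op[OF linear]])
  then show "spectral_proj A (c *\<^sub>R x) = c *\<^sub>R spectral_proj A x"
    using p[of "c *\<^sub>R x"] LIMSEQ_unique by blast
qed

lemma symmetric_spectral_proj:
  assumes A: "A \<in> sets borel"
  shows "spectral_proj A x \<bullet> y = x \<bullet> spectral_proj A y"
proof -
  have fin: "finite {x, y}" by simp
  obtain p where "\<forall>z\<in>{x, y}. (\<lambda>n. L2_error z (p n) A) \<longlonglongrightarrow> 0 \<and>
      (\<lambda>n. poly_op T (p n) z) \<longlonglongrightarrow> spectral_proj A z"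
    using spectral_proj_approx[OF fin A] by (rule exE)
  then have p: "(\<lambda>n. poly_op T (p n) z) \<longlonglongrightarrow> spectral_proj A z" if "z \<in> {x, y}" for z
    using that by (simp only:)
  have "(\<lambda>n. poly_op T (p n) x \<bullet> y) \<longlonglongrightarrow> spectral_proj A x \<bullet> y"
    by (intro tendsto_intros p) simp
  moreover have "(\<lambda>n. poly_op T (p n) x \<bullet> y) \<longlonglongrightarrow> x \<bullet> spectral_proj A y"
    unfolding inner_poly_op[OF linear symmetric] by (intro tendsto_intros p) simp
  ultimately show ?thesis by (rule LIMSEQ_unique)
qed

text \<open>Since \<open>1\<^sub>A\<^sup>2 = 1\<^sub>A\<close>, both \<open>\<integral> p\<^sub>n d\<mu>\<^sub>x\<close> and \<open>\<integral> p\<^sub>n\<^sup>2 d\<mu>\<^sub>x\<close> tend to \<open>\<mu>\<^sub>x(A)\<close>. That the two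
values agree is what makes \<open>E(A)\<close> idempotent.\<close>

lemma measure_spectral_proj:
  assumes A: "A \<in> sets borel"
  shows "x \<bullet> spectral_proj A x = measure (moment_measure x) A"
    and "(norm (spectral_proj A x))\<^sup>2 = measure (moment_measure x) A"
proof -
  interpret finite_measure "moment_measure x" by (rule finite_moment_measure)
  obtain p where err: "(\<lambda>n. L2_error x (p n) A) \<longlonglongrightarrow> 0"
    and p: "(\<lambda>n. poly_op T (p n) x) \<longlonglongrightarrow> spectral_proj A x"
    using spectral_proj_approx[of "{x}" A] A by auto
  note ints = integrable_poly_indicator[OF A]
  have intA: "integrable (moment_measure x) (indicator A :: real \<Rightarrow> real)"
    using A by (simp add: integrable_indicator_iff emeasure_eq_measure)
  have "(\<lambda>n. \<integral>t. poly (p n) t - indicator A t \<partial>moment_measure x) \<longlonglongrightarrow> 0"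
    by (rule tendsto_integral_of_square[OF finite_moment_measure _ _ err]) (simp_all add: ints)
  moreover have "(\<integral>t. poly (p n) t - indicator A t \<partial>moment_measure x)
      = x \<bullet> poly_op T (p n) x - measure (moment_measure x) A" for n
    using ints(1) intA by (simp add: integral_poly A)
  ultimately have "(\<lambda>n. x \<bullet> poly_op T (p n) x) \<longlonglongrightarrow> measure (moment_measure x) A"
    by (simp add: LIM_zero_iff)
  moreover have "(\<lambda>n. x \<bullet> poly_op T (p n) x) \<longlonglongrightarrow> x \<bullet> spectral_proj A x"
    by (intro tendsto_intros p)
  ultimately show "x \<bullet> spectral_proj A x = measure (moment_measure x) A"
    using LIMSEQ_unique by blast
  have "(\<lambda>n. \<integral>t. (poly (p n) t - indicator A t) * indicator A t \<partial>moment_measure x) \<longlonglongrightarrow> 0"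
  proof (rule tendsto_integral_of_square[OF finite_moment_measure])
    show "(\<lambda>n. \<integral>t. ((poly (p n) t - indicator A t) * indicator A t)\<^sup>2 \<partial>moment_measure x) \<longlonglongrightarrow> 0"
    proof (rule Lim_null_comparison[OF always_eventually err], rule allI)
      fix n
      have "(\<integral>t. ((poly (p n) t - indicator A t) * indicator A t)\<^sup>2 \<partial>moment_measure x)
          \<le> L2_error x (p n) A"
        using ints by (intro integral_mono) (auto simp: indicator_def)
      then show "norm (\<integral>t. ((poly (p n) t - indicator A t) * indicator A t)\<^sup>2 \<partial>moment_measure x)
          \<le> L2_error x (p n) A"
        by simp
    qed
  qed (rule ints)+
  from tendsto_add[OF err tendsto_mult_left[OF this, of 2]]
  have "(\<lambda>n. L2_error x (p n) A + 2 * (\<integral>t. (poly (p n) t - indicator A t) * indicator A t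
      \<partial>moment_measure x)) \<longlonglongrightarrow> 0"
    by simp
  moreover have "L2_error x (p n) A + 2 * (\<integral>t. (poly (p n) t - indicator A t) * indicator A t
      \<partial>moment_measure x)
      = (norm (poly_op T (p n) x))\<^sup>2 - measure (moment_measure x) A" for n
  proof -
    have "(poly (p n) t)\<^sup>2 = (poly (p n) t - indicator A t)\<^sup>2
        + 2 * ((poly (p n) t - indicator A t) * indicator A t) + indicator A t" for t
      by (simp add: indicator_def power2_eq_square algebra_simps)
    then have "(norm (poly_op T (p n) x))\<^sup>2 = (\<integral>t. (poly (p n) t - indicator A t)\<^sup>2
        + 2 * ((poly (p n) t - indicator A t) * indicator A t) + indicator A t \<partial>moment_measure x)"
      by (simp only: norm_poly_op)
    then show ?thesis using ints intA A by simp
  qed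
  ultimately have "(\<lambda>n. (norm (poly_op T (p n) x))\<^sup>2) \<longlonglongrightarrow> measure (moment_measure x) A"
    by (simp add: LIM_zero_iff)
  moreover have "(\<lambda>n. (norm (poly_op T (p n) x))\<^sup>2) \<longlonglongrightarrow> (norm (spectral_proj A x))\<^sup>2"
    by (intro tendsto_intros p)
  ultimately show "(norm (spectral_proj A x))\<^sup>2 = measure (moment_measure x) A"
    using LIMSEQ_unique by blast
qed

lemma bounded_linear_spectral_proj:
  assumes A: "A \<in> sets borel"
  shows "bounded_linear (spectral_proj A)"
proof (rule bounded_linear_intro[where K = 1])
  show "norm (spectral_proj A x) \<le> norm x * 1" for x
  proof -
    have "(norm (spectral_proj A x))\<^sup>2 \<le> norm x * norm (spectral_proj A x)"
      using norm_cauchy_schwarz[of x "spectral_proj A x"] by (simp add: measure_spectral_proj[OF A])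
    then show ?thesis by (cases "spectral_proj A x = 0") (simp_all add: power2_eq_square)
  qed
qed (use linear_add[OF linear_spectral_proj[OF A]] linear_scale[OF linear_spectral_proj[OF A]] in auto)

text \<open>For \<open>P = E(A)\<close> the quadratic forms \<open>\<parallel>P x\<parallel>\<^sup>2\<close> and \<open>(x, P x)\<close> coincide, hence so do their
bilinear forms, which are those of \<open>P\<^sup>2\<close> and \<open>P\<close>.\<close>

lemma idempotent_spectral_proj:
  assumes A: "A \<in> sets borel"
  shows "spectral_proj A (spectral_proj A x) = spectral_proj A x"
proof (rule vector_eq_ldot[THEN iffD1], rule allI)
  fix y
  let ?P = "spectral_proj A"
  have "(norm (?P (x + y)))\<^sup>2 = (x + y) \<bullet> ?P (x + y)"
    by (simp add: measure_spectral_proj[OF A])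
  then have "(norm (?P x))\<^sup>2 + 2 * (?P y \<bullet> ?P x) + (norm (?P y))\<^sup>2
      = x \<bullet> ?P x + x \<bullet> ?P y + y \<bullet> ?P x + y \<bullet> ?P y"
    by (simp add: linear_add[OF linear_spectral_proj[OF A]] power2_norm_eq_inner inner_add_left
      inner_add_right inner_commute algebra_simps)
  moreover have "x \<bullet> ?P y = y \<bullet> ?P x"
    by (metis symmetric_spectral_proj[OF A] inner_commute)
  moreover have "y \<bullet> ?P (?P x) = ?P y \<bullet> ?P x"
    by (simp add: symmetric_spectral_proj[OF A])
  ultimately show "y \<bullet> ?P (?P x) = y \<bullet> ?P x"
    by (simp add: measure_spectral_proj[OF A])
qed

lemma spectral_proj_disjoint_Un:
  assumes A: "A \<in> sets borel" and B: "B \<in> sets borel" and disj: "A \<inter> B = {}"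
  shows "spectral_proj (A \<union> B) x = spectral_proj A x + spectral_proj B x"
proof -
  obtain p where p: "(\<lambda>n. L2_error x (p n) A) \<longlonglongrightarrow> 0"
    "(\<lambda>n. poly_op T (p n) x) \<longlonglongrightarrow> spectral_proj A x"
    using spectral_proj_approx[of "{x}" A] A by auto
  obtain q where q: "(\<lambda>n. L2_error x (q n) B) \<longlonglongrightarrow> 0"
    "(\<lambda>n. poly_op T (q n) x) \<longlonglongrightarrow> spectral_proj B x"
    using spectral_proj_approx[of "{x}" B] B by auto
  have "(\<lambda>n. L2_error x (p n + q n) (A \<union> B)) \<longlonglongrightarrow> 0"
  proof (rule Lim_null_comparison[OF always_eventually], rule allI)
    have "(\<lambda>n. 2 * L2_error x (p n) A + 2 * L2_error x (q n) B) \<longlonglongrightarrow> 2 * 0 + 2 * 0"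
      by (intro tendsto_intros p q)
    then show "(\<lambda>n. 2 * L2_error x (p n) A + 2 * L2_error x (q n) B) \<longlonglongrightarrow> 0" by simp
    fix n
    note intA = integrable_poly_indicator(3)[OF A] and intB = integrable_poly_indicator(3)[OF B]
    have "L2_error x (p n + q n) (A \<union> B)
        \<le> (\<integral>t. 2 * (poly (p n) t - indicator A t)\<^sup>2
            + 2 * (poly (q n) t - indicator B t)\<^sup>2 \<partial>moment_measure x)"
    proof (rule integral_mono)
      fix t
      have "indicator (A \<union> B) t = (indicator A t + indicator B t :: real)"
        using disj by (auto simp: indicator_def)
      then have "(poly (p n + q n) t - indicator (A \<union> B) t)\<^sup>2
          = ((poly (p n) t - indicator A t) + (poly (q n) t - indicator B t))\<^sup>2"
        by (simp add: algebra_simps)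
      also have "\<dots> \<le> 2 * (poly (p n) t - indicator A t)\<^sup>2 + 2 * (poly (q n) t - indicator B t)\<^sup>2"
        using sum_squares_bound[of "poly (p n) t - indicator A t" "poly (q n) t - indicator B t"]
        by (simp add: power2_sum)
      finally show "(poly (p n + q n) t - indicator (A \<union> B) t)\<^sup>2
          \<le> 2 * (poly (p n) t - indicator A t)\<^sup>2 + 2 * (poly (q n) t - indicator B t)\<^sup>2" .
    qed (use intA intB integrable_poly_indicator(3)[of "A \<union> B" x "p n + q n"] A B in auto)
    also have "\<dots> = 2 * L2_error x (p n) A + 2 * L2_error x (q n) B"
      using intA intB by simp
    finally show "norm (L2_error x (p n + q n) (A \<union> B))
        \<le> 2 * L2_error x (p n) A + 2 * L2_error x (q n) B"
      by simp
  qed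
  from tendsto_spectral_proj[OF _ this]
  have "(\<lambda>n. poly_op T (p n + q n) x) \<longlonglongrightarrow> spectral_proj (A \<union> B) x" using A B by simp
  moreover have "(\<lambda>n. poly_op T (p n + q n) x) \<longlonglongrightarrow> spectral_proj A x + spectral_proj B x"
    unfolding poly_op_add[OF linear] by (intro tendsto_intros p q)
  ultimately show ?thesis by (rule LIMSEQ_unique)
qed

text \<open>The remainder after \<open>n\<close> terms is \<open>E\<close> of the tail of the union, and its squared norm is the
\<open>\<mu>\<^sub>x\<close>-measure of the tail.\<close>

lemma spectral_proj_sums:
  assumes A: "range A \<subseteq> sets borel" and disj: "disjoint_family A"
  shows "(\<lambda>n. spectral_proj (A n) x) sums spectral_proj (\<Union>n. A n) x"
proof -
  interpret finite_measure "moment_measure x" by (rule finite_moment_measure)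
  have A': "A n \<in> sets borel" for n using A by auto
  have fin: "(\<Sum>i<n. spectral_proj (A i) x) = spectral_proj (\<Union>i<n. A i) x" for n
  proof (induction n)
    case 0
    have "(norm (spectral_proj {} x))\<^sup>2 = 0" by (subst measure_spectral_proj) auto
    then show ?case by simp
  next
    case (Suc n)
    have "(\<Union>i<Suc n. A i) = (\<Union>i<n. A i) \<union> A n" by (auto simp: less_Suc_eq)
    moreover have "A i \<inter> A n = {}" if "i < n" for i
      using disj that by (simp add: disjoint_family_on_def)
    then have "(\<Union>i<n. A i) \<inter> A n = {}" by blast
    ultimately show ?case
      using A' by (simp add: Suc.IH spectral_proj_disjoint_Un)
  qed
  have "(\<lambda>n. (norm (spectral_proj (\<Union>n. A n) x - (\<Sum>i<n. spectral_proj (A i) x)))\<^sup>2) \<longlonglongrightarrow> 0"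
  proof -
    have "(norm (spectral_proj (\<Union>n. A n) x - (\<Sum>i<n. spectral_proj (A i) x)))\<^sup>2
        = measure (moment_measure x) (\<Union>n. A n) - (\<Sum>i<n. measure (moment_measure x) (A i))" for n
    proof -
      let ?U = "\<Union>n. A n" and ?V = "\<Union>i<n. A i"
      have UV: "?U \<in> sets borel" "?V \<in> sets borel" "?V \<subseteq> ?U" using A' by auto
      have "?U = ?V \<union> (?U - ?V)" by blast
      then have "spectral_proj ?U x = spectral_proj ?V x + spectral_proj (?U - ?V) x"
        using UV spectral_proj_disjoint_Un[of ?V "?U - ?V" x] by (metis Diff_disjoint sets.Diff)
      then have "(norm (spectral_proj ?U x - (\<Sum>i<n. spectral_proj (A i) x)))\<^sup>2
          = measure (moment_measure x) (?U - ?V)"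
        using UV by (simp add: fin measure_spectral_proj)
      also have "\<dots> = measure (moment_measure x) ?U - measure (moment_measure x) ?V"
        using UV by (intro finite_measure_Diff) auto
      also have "measure (moment_measure x) ?V = (\<Sum>i<n. measure (moment_measure x) (A i))"
        using A' disj by (intro finite_measure_finite_Union) (auto simp: disjoint_family_on_def)
      finally show ?thesis .
    qed
    moreover have lim: "(\<lambda>n. \<Sum>i<n. measure (moment_measure x) (A i))
        \<longlonglongrightarrow> measure (moment_measure x) (\<Union>n. A n)"
      using finite_measure_UNION[of A] A disj by (simp add: sums_def)
    ultimately show ?thesis
      using tendsto_diff[OF tendsto_const lim, of "measure (moment_measure x) (\<Union>n. A n)"] by simp
  qed
  then have "(\<lambda>n. spectral_proj (\<Union>n. A n) x - (\<Sum>i<n. spectral_proj (A i) x)) \<longlonglongrightarrow> 0"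
    by (simp add: power_tendsto_0_iff tendsto_norm_zero_iff)
  from tendsto_diff[OF tendsto_const this, of "spectral_proj (\<Union>n. A n) x"]
  show ?thesis by (simp add: sums_def)
qed

lemma scalar_measure_spectral_proj: "scalar_measure spectral_proj x = moment_measure x"
proof -
  interpret finite_measure "moment_measure x" by (rule finite_moment_measure)
  have "scalar_measure spectral_proj x
      = measure_of (space (moment_measure x)) (sets (moment_measure x)) (emeasure (moment_measure x))"
    unfolding scalar_measure_def space_moment_measure sets_moment_measure
    by (rule measure_of_eq) (auto simp: measure_spectral_proj emeasure_eq_measure
        sets.sigma_sets_eq[of borel, simplified])
  then show ?thesis by (simp only: measure_of_of_measure)
qed

lemma spectral_proj_UNIV: "spectral_proj UNIV = id"
proof
  fix x
  have "(norm (poly_op T 1 x - spectral_proj UNIV x))\<^sup>2 \<le> 0"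
    using spectral_proj_error[of UNIV 1 x] by simp
  then show "spectral_proj UNIV x = id x" by (simp add: poly_op_simps)
qed

theorem spectral_resolution_spectral_proj: "spectral_resolution T spectral_proj"
  unfolding spectral_resolution_def projection_valued_measure_def
proof (intro conjI ballI allI impI)
  have poly_id: "poly [:0, 1 :: real:] = (\<lambda>t. t)" by (simp add: fun_eq_iff)
  show "integrable (scalar_measure spectral_proj x) (\<lambda>t. t)" for x
    using integrable_poly_indicator(1)[OF space_in_borel, of x "[:0, 1:]"]
    unfolding poly_id scalar_measure_spectral_proj .
  show "x \<bullet> T x = integral\<^sup>L (scalar_measure spectral_proj x) (\<lambda>t. t)" for x
    using integral_poly[of x "[:0, 1:]"] by (simp add: scalar_measure_spectral_proj poly_op_simps)
qed (auto simp: bounded_linear_spectral_proj idempotent_spectral_proj symmetric_spectral_proj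
    spectral_proj_UNIV spectral_proj_sums)

end

section \<open>Completeness of the space of square-integrable functions\<close>

lemma abs_L2_cases:
  obtains f where "square_integrable f" "X = abs_L2 f"
proof -
  have "L2_eq (rep_L2 X) (rep_L2 X)" "abs_L2 (rep_L2 X) = X"
    using Quotient_L2 by (auto simp: Quotient_def)
  with that[of "rep_L2 X"] show ?thesis by (auto simp: L2_eq_def)
qed

lemma abs_L2_diff:
  assumes "square_integrable f" "square_integrable g"
  shows "abs_L2 f - abs_L2 g = abs_L2 (\<lambda>x. f x - g x)"
  using assms by (intro minus_L2.abs_eq) (auto simp: L2_eq_def)

lemma nn_integral_norm_L2:
  fixes f :: "real \<Rightarrow> 'a::euclidean_space"
  assumes "square_integrable f"
  shows "(\<integral>\<^sup>+x. ennreal ((norm (f x))\<^sup>2) \<partial>lborel) = ennreal ((norm (abs_L2 f))\<^sup>2)"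
proof -
  have "(norm (abs_L2 f))\<^sup>2 = (\<integral>x. f x \<bullet> f x \<partial>lborel)"
    using assms inner_L2.abs_eq[of f f] by (simp add: power2_norm_eq_inner L2_eq_def)
  then show ?thesis
    using assms by (simp add: nn_integral_eq_integral square_integrable_def power2_norm_eq_inner)
qed

lemma square_integrableI_nn_integral:
  fixes f :: "real \<Rightarrow> 'a::euclidean_space"
  assumes "f \<in> borel_measurable lborel" "(\<integral>\<^sup>+x. ennreal ((norm (f x))\<^sup>2) \<partial>lborel) < \<infinity>"
  shows "square_integrable f"
  unfolding square_integrable_def
proof
  show "integrable lborel (\<lambda>x. (norm (f x))\<^sup>2)"
    using assms by (intro integrableI_bounded) auto
qed fact

text \<open>A subsequence with geometrically decreasing steps converges almost everywhere, because the
weighted sum of the squared steps has finite integral; Fatou's lemma then shows that the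
pointwise limit is also the limit in norm.\<close>

instance L2 :: (euclidean_space) complete_space
proof
  fix X :: "nat \<Rightarrow> 'a L2"
  assume "Cauchy X"
  have "\<exists>N. \<forall>i\<ge>N. \<forall>j\<ge>N. dist (X i) (X j) < (1 / 2) ^ k" for k
    using \<open>Cauchy X\<close> by (intro metric_CauchyD) auto
  then obtain N where N: "\<And>k i j. i \<ge> N k \<Longrightarrow> j \<ge> N k \<Longrightarrow> dist (X i) (X j) < (1 / 2) ^ k"
    by metis
  \<comment> \<open>This index is strictly increasing and dominates every \<open>N i\<close> with \<open>i \<le> k\<close>.\<close>
  define r where "r k = k + (\<Sum>i\<le>k. N i)" for k
  have r: "strict_mono r" by (auto simp: strict_mono_Suc_iff r_def)
  have rN: "N k \<le> r n" if "k \<le> n" for k n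
    using member_le_sum[of k "{..n}" N] that by (simp add: r_def)
  have "\<exists>f. square_integrable f \<and> X n = abs_L2 f" for n
    using abs_L2_cases by metis
  then obtain f where "\<And>n. square_integrable (f n)" "\<And>n. X n = abs_L2 (f n)" by metis
  define g where "g n = f (r n)" for n
  have g: "square_integrable (g n)" "X (r n) = abs_L2 (g n)" for n
    using \<open>square_integrable (f (r n))\<close> \<open>X (r n) = abs_L2 (f (r n))\<close> by (simp_all add: g_def)
  then have g_meas [measurable]: "g n \<in> borel_measurable lborel" for n
    by (simp add: square_integrable_def)
  have g_diff: "(\<integral>\<^sup>+x. ennreal ((norm (g m x - g n x))\<^sup>2) \<partial>lborel) \<le> ennreal ((1 / 4) ^ m)" if "m
      \<le> n" for m n
  proof -
    have "norm (X (r m) - X (r n)) < (1 / 2) ^ m"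
      using N[of m "r m" "r n"] rN[of m m] rN[of m n] that by (simp add: dist_norm)
    then have "(norm (X (r m) - X (r n)))\<^sup>2 \<le> ((1 / 2) ^ m)\<^sup>2" by (intro power_mono) auto
    also have "((1 / 2) ^ m)\<^sup>2 = (1 / 4 :: real) ^ m"
      unfolding power2_eq_square power_mult_distrib[symmetric] by simp
    finally show ?thesis
      using nn_integral_norm_L2[OF square_integrable_diff[OF g(1)[of m] g(1)[of n]]]
      by (simp add: g abs_L2_diff ennreal_leI)
  qed
  have "AE x in lborel. (\<Sum>n. ennreal (2 ^ n * (norm (g n x - g (Suc n) x))\<^sup>2)) \<noteq> \<infinity>"
  proof (rule nn_integral_PInf_AE)
    have "(\<integral>\<^sup>+x. (\<Sum>n. ennreal (2 ^ n * (norm (g n x - g (Suc n) x))\<^sup>2)) \<partial>lborel)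
        = (\<Sum>n. ennreal (2 ^ n) * (\<integral>\<^sup>+x. ennreal ((norm (g n x - g (Suc n) x))\<^sup>2) \<partial>lborel))"
      by (simp add: nn_integral_suminf nn_integral_cmult ennreal_mult)
    also have "\<dots> \<le> (\<Sum>n. ennreal ((1 / 2) ^ n))"
    proof (intro suminf_le summableI)
      fix n
      have "ennreal (2 ^ n) * (\<integral>\<^sup>+x. ennreal ((norm (g n x - g (Suc n) x))\<^sup>2) \<partial>lborel)
          \<le> ennreal (2 ^ n) * ennreal ((1 / 4) ^ n)"
        by (intro mult_left_mono g_diff) auto
      also have "\<dots> = ennreal ((1 / 2) ^ n)"
        by (simp flip: ennreal_mult power_mult_distrib)
      finally show "ennreal (2 ^ n) * (\<integral>\<^sup>+x. ennreal ((norm (g n x - g (Suc n) x))\<^sup>2) \<partial>lborel)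
          \<le> ennreal ((1 / 2) ^ n)" .
    qed
    also have "\<dots> = ennreal 2"
      by (rule suminf_ennreal_eq) (use geometric_sums[of "1 / 2 :: real"] in auto)
    also have "\<dots> < \<infinity>" by simp
    finally show "(\<integral>\<^sup>+x. (\<Sum>n. ennreal (2 ^ n * (norm (g n x - g (Suc n) x))\<^sup>2)) \<partial>lborel) \<noteq> \<infinity>" by simp
  qed measurable
  then have conv: "AE x in lborel. (\<lambda>n. g n x) \<longlonglongrightarrow> lim (\<lambda>n. g n x)"
  proof eventually_elim
    fix x
    assume "(\<Sum>n. ennreal (2 ^ n * (norm (g n x - g (Suc n) x))\<^sup>2)) \<noteq> \<infinity>"
    then have "summable (\<lambda>n. 2 ^ n * (norm (g n x - g (Suc n) x))\<^sup>2)"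
      by (intro summable_suminf_not_top) auto
    then have "summable (\<lambda>n. 2 ^ n * (norm (g n x - g (Suc n) x))\<^sup>2 + (1 / 2) ^ n)"
      by (intro summable_add summable_geometric) auto
    then have "summable (\<lambda>n. g (Suc n) x - g n x)"
    proof (rule summable_comparison_test[OF exI, rotated], intro allI impI)
      fix n
      \<comment> \<open>Summability of the steps from that of their weighted squares: \<open>z \<le> s z\<^sup>2 + 1 / s\<close> with \<open>s
          = 2 ^ n\<close>.\<close>
      define s where "s = (2 :: real) ^ n"
      define z where "z = norm (g n x - g (Suc n) x)"
      have s: "s > 0" by (simp add: s_def)
      have "0 \<le> (s * z - 1)\<^sup>2" by simp
      then have "2 * (s * z) \<le> s * (s * z\<^sup>2) + 1" by (simp add: power2_eq_square algebra_simps)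
      moreover have "0 \<le> s * z" using s by (simp add: z_def)
      ultimately have "s * z \<le> s * (s * z\<^sup>2 + 1 / s)" using s by (simp add: algebra_simps)
      then have "z \<le> s * z\<^sup>2 + 1 / s" using s by (rule mult_left_le_imp_le)
      then show "norm (g (Suc n) x - g n x) \<le> 2 ^ n * (norm (g n x - g (Suc n) x))\<^sup>2 + (1 / 2) ^ n"
        by (simp add: s_def z_def norm_minus_commute power_one_over)
    qed
    then obtain l where "(\<lambda>n. g n x - g 0 x) \<longlonglongrightarrow> l"
      by (auto simp: summable_def sums_def sum_lessThan_telescope[of "\<lambda>n. g n x"])
    from tendsto_add[OF this tendsto_const[of "g 0 x"]]
    have "convergent (\<lambda>n. g n x)" by (auto simp: convergent_def)
    then show "(\<lambda>n. g n x) \<longlonglongrightarrow> lim (\<lambda>n. g n x)" by (simp add: convergent_LIMSEQ_iff)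
  qed
  define F where "F x = lim (\<lambda>n. g n x)" for x
  have F_meas [measurable]: "F \<in> borel_measurable lborel"
    unfolding F_def by (rule borel_measurable_lim_metric) measurable
  have F_diff: "(\<integral>\<^sup>+x. ennreal ((norm (g m x - F x))\<^sup>2) \<partial>lborel) \<le> ennreal ((1 / 4) ^ m)" for m
  proof -
    have "(\<integral>\<^sup>+x. ennreal ((norm (g m x - F x))\<^sup>2) \<partial>lborel)
        \<le> (\<integral>\<^sup>+x. liminf (\<lambda>n. ennreal ((norm (g m x - g n x))\<^sup>2)) \<partial>lborel)"
    proof (rule nn_integral_mono_AE)
      show "AE x in lborel. ennreal ((norm (g m x - F x))\<^sup>2)
          \<le> liminf (\<lambda>n. ennreal ((norm (g m x - g n x))\<^sup>2))"
        using conv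
      proof eventually_elim
        case (elim x)
        then have "(\<lambda>n. ennreal ((norm (g m x - g n x))\<^sup>2)) \<longlonglongrightarrow> ennreal ((norm (g m x - F x))\<^sup>2)"
          unfolding F_def by (intro tendsto_intros tendsto_ennrealI)
        from lim_imp_Liminf[OF _ this] show ?case by simp
      qed
    qed
    also have "\<dots> \<le> liminf (\<lambda>n. \<integral>\<^sup>+x. ennreal ((norm (g m x - g n x))\<^sup>2) \<partial>lborel)"
      by (rule nn_integral_liminf) measurable
    also have "\<dots> \<le> ennreal ((1 / 4) ^ m)"
      by (rule Liminf_le) (auto simp: eventually_sequentially intro!: exI[of _ m] g_diff)
    finally show ?thesis .
  qed
  have gF: "square_integrable (\<lambda>x. g m x - F x)" for m
    using F_diff[of m] by (intro square_integrableI_nn_integral) (auto intro: le_less_trans)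
  have F: "square_integrable F"
    using square_integrable_diff[OF g(1)[of 0] gF[of 0]] by simp
  have bound: "norm (X (r m) - abs_L2 F) \<le> (1 / 2) ^ m" for m
  proof -
    have "ennreal ((norm (X (r m) - abs_L2 F))\<^sup>2) \<le> ennreal ((1 / 4) ^ m)"
      using F_diff[of m] nn_integral_norm_L2[OF gF[of m]] by (simp add: g abs_L2_diff F)
    then have "(norm (X (r m) - abs_L2 F))\<^sup>2 \<le> (1 / 4) ^ m" by simp
    also have "(1 / 4 :: real) ^ m = ((1 / 2) ^ m)\<^sup>2"
      unfolding power2_eq_square power_mult_distrib[symmetric] by simp
    finally show ?thesis by (rule power2_le_imp_le) simp
  qed
  have "(\<lambda>m. X (r m) - abs_L2 F) \<longlonglongrightarrow> 0"
    by (rule Lim_null_comparison[OF always_eventually[OF allI[OF bound]]]) (simp add: LIMSEQ_power_zero)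
  then have "(X \<circ> r) \<longlonglongrightarrow> abs_L2 F" by (simp add: LIM_zero_iff comp_def)
  then show "convergent X"
    using Cauchy_converges_subseq[OF \<open>Cauchy X\<close> r] unfolding convergent_def by blast
qed

section \<open>Integration against projection-valued measures\<close>

context
  fixes E :: "real set \<Rightarrow> 'h::real_inner \<Rightarrow> 'h"
  assumes pvm: "projection_valued_measure E"
begin

lemma pvm_bounded_linear: "A \<in> sets borel \<Longrightarrow> bounded_linear (E A)"
  using pvm by (auto simp: projection_valued_measure_def)

lemma pvm_inner: "A \<in> sets borel \<Longrightarrow> E A x \<bullet> y = E A x \<bullet> E A y"
  using pvm unfolding projection_valued_measure_def by (metis comp_apply)

lemma pvm_norm: "A \<in> sets borel \<Longrightarrow> x \<bullet> E A x = (norm (E A x))\<^sup>2"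
  using pvm_inner[of A x x] by (simp add: power2_norm_eq_inner inner_commute)

lemma pvm_UNIV: "E UNIV x = x"
  using pvm by (simp add: projection_valued_measure_def)

lemma pvm_sums:
  "range A \<subseteq> sets borel \<Longrightarrow> disjoint_family A \<Longrightarrow> (\<lambda>n::nat. E (A n) x) sums E (\<Union>n. A n) x"
  using pvm by (auto simp: projection_valued_measure_def)

lemma pvm_empty: "E {} x = 0"
proof -
  have "(\<lambda>n::nat. E {} x) sums E (\<Union>n::nat. {}) x"
    by (rule pvm_sums) (auto simp: disjoint_family_on_def)
  then have "(\<lambda>n::nat. E {} x) \<longlonglongrightarrow> 0"
    by (intro summable_LIMSEQ_zero) (auto simp: sums_iff)
  then show ?thesis by (simp add: LIMSEQ_const_iff)
qed

lemma pvm_disjoint_Un: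
  assumes "A \<in> sets borel" "B \<in> sets borel" "A \<inter> B = {}"
  shows "E (A \<union> B) x = E A x + E B x"
proof -
  have "(\<lambda>n. E (binaryset A B n) x) sums E (\<Union>n. binaryset A B n) x"
    using assms by (intro pvm_sums) (auto simp: binaryset_def disjoint_family_on_def)
  then have "(\<lambda>n. E (binaryset A B n) x) sums E (A \<union> B) x" by (simp add: UN_binaryset_eq)
  moreover have "(\<lambda>n. E (binaryset A B n) x) sums (\<Sum>n<2. E (binaryset A B n) x)"
    by (rule sums_finite) (auto simp: binaryset_def pvm_empty)
  ultimately show ?thesis
    using sums_unique2 by (fastforce simp: binaryset_def numeral_2_eq_2)
qed

lemma sets_scalar_measure [simp]: "sets (scalar_measure E x) = sets borel"
  and space_scalar_measure [simp]: "space (scalar_measure E x) = UNIV"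
  using sets.sigma_sets_eq[of borel] by (simp_all add: scalar_measure_def sets_measure_of_conv
      space_measure_of_conv)

lemma emeasure_scalar_measure:
  assumes "A \<in> sets borel"
  shows "emeasure (scalar_measure E x) A = ennreal ((norm (E A x))\<^sup>2)"
proof -
  have "emeasure (scalar_measure E x) A = ennreal (x \<bullet> E A x)"
    unfolding scalar_measure_def
  proof (rule emeasure_measure_of_sigma)
    show "sigma_algebra UNIV (sets borel)"
      using sets.sigma_algebra_axioms[of borel] by simp
    show "positive (sets borel) (\<lambda>A. ennreal (x \<bullet> E A x))"
      by (simp add: positive_def pvm_empty)
    show "countably_additive (sets borel) (\<lambda>A. ennreal (x \<bullet> E A x))"
    proof (rule countably_additiveI)
      fix A :: "nat \<Rightarrow> real set"
      assume A: "range A \<subseteq> sets borel" "disjoint_family A"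
      have "(\<lambda>n. x \<bullet> E (A n) x) sums (x \<bullet> E (\<Union>n. A n) x)"
        by (rule bounded_linear.sums[OF bounded_linear_inner_right pvm_sums[OF A]])
      then show "(\<Sum>n. ennreal (x \<bullet> E (A n) x)) = ennreal (x \<bullet> E (\<Union>n. A n) x)"
        using A pvm_norm by (intro suminf_ennreal_eq) (auto simp: range_subsetD)
    qed
  qed fact
  then show ?thesis using pvm_norm[OF assms] by simp
qed

lemma finite_scalar_measure: "finite_measure (scalar_measure E x)"
  by (rule finite_measureI) (simp add: emeasure_scalar_measure)

lemma measure_scalar_measure:
  "A \<in> sets borel \<Longrightarrow> measure (scalar_measure E x) A = (norm (E A x))\<^sup>2"
  by (simp add: measure_def emeasure_scalar_measure)

end

text \<open>Domination by a combination of two measures passes from sets to integrals. Going through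
simple functions avoids building the combined measure.\<close>

lemma nn_integral_le_of_measure_le:
  assumes sets: "sets M = sets L" "sets N = sets L"
    and le: "\<And>A. A \<in> sets L \<Longrightarrow> emeasure L A \<le> \<alpha> * emeasure M A + \<beta> * emeasure N A"
  shows "(\<integral>\<^sup>+x. f x \<partial>L) \<le> \<alpha> * (\<integral>\<^sup>+x. f x \<partial>M) + \<beta> * (\<integral>\<^sup>+x. f x \<partial>N)"
  unfolding nn_integral_def[of L]
proof (rule SUP_least)
  fix h assume "h \<in> {h. simple_function L h \<and> h \<le> f}"
  then have h: "simple_function L h" "h \<le> f" by auto
  note space = sets_eq_imp_space_eq[OF sets(1)] sets_eq_imp_space_eq[OF sets(2)]
  have h': "simple_function M h" "simple_function N h"
    using h(1) sets space by (simp_all add: simple_function_def)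
  have "integral\<^sup>S L h \<le> (\<Sum>y\<in>h ` space L. y * (\<alpha> * emeasure M (h -` {y} \<inter> space L)
      + \<beta> * emeasure N (h -` {y} \<inter> space L)))"
    unfolding simple_integral_def using h(1)
    by (intro sum_mono mult_left_mono le) (auto simp: simple_function_def)
  also have "\<dots> = \<alpha> * integral\<^sup>S M h + \<beta> * integral\<^sup>S N h"
    by (simp add: simple_integral_def space sum_distrib_left sum.distrib distrib_left mult_ac)
  also have "\<dots> = \<alpha> * (\<integral>\<^sup>+x. h x \<partial>M) + \<beta> * (\<integral>\<^sup>+x. h x \<partial>N)"
    using h' by (simp add: nn_integral_eq_simple_integral)
  also have "\<dots> \<le> \<alpha> * (\<integral>\<^sup>+x. f x \<partial>M) + \<beta> * (\<integral>\<^sup>+x. f x \<partial>N)"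
    using h(2) by (intro add_mono mult_left_mono nn_integral_mono) (auto simp: le_fun_def)
  finally show "integral\<^sup>S L h \<le> \<alpha> * (\<integral>\<^sup>+x. f x \<partial>M) + \<beta> * (\<integral>\<^sup>+x. f x \<partial>N)" .
qed

lemma norm_diff_square_le:
  fixes u v :: "'a::real_inner"
  assumes "0 < s"
  shows "(norm (u - v))\<^sup>2 \<le> (1 + s) * (norm u)\<^sup>2 + (1 + 1 / s) * (norm v)\<^sup>2"
proof -
  have "0 \<le> (1 / s) * (norm (s *\<^sub>R u + v))\<^sup>2" using assms by simp
  also have "\<dots> = s * (norm u)\<^sup>2 + 2 * (u \<bullet> v) + (1 / s) * (norm v)\<^sup>2"
    using assms by (simp add: power2_norm_eq_inner inner_add_left inner_add_right inner_commute
        field_simps)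
  finally show ?thesis
    by (simp add: power2_norm_eq_inner inner_diff_left inner_diff_right inner_commute algebra_simps)
qed

text \<open>The square root of \<open>\<integral> \<phi> d(x, E x)\<close> is a seminorm in \<open>x\<close> for \<open>\<phi> \<ge> 0\<close>. Setwise the inequality
\<open>\<parallel>u - v\<parallel>\<^sup>2 \<le> (1 + s) \<parallel>u\<parallel>\<^sup>2 + (1 + 1/s) \<parallel>v\<parallel>\<^sup>2\<close> for \<open>u = E(A) a\<close> and \<open>v = E(A) b\<close> is linear in the
measures, so it can be integrated; the best \<open>s\<close> is chosen afterwards.\<close>

lemma scalar_measure_triangle:
  fixes \<phi> :: "real \<Rightarrow> real"
  assumes pvm: "projection_valued_measure E"
    and \<phi>: "\<And>t. 0 \<le> \<phi> t" "integrable (scalar_measure E a) \<phi>" "integrable (scalar_measure E b) \<phi>"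
  shows "integrable (scalar_measure E (a - b)) \<phi>"
    and "(\<integral>t. \<phi> t \<partial>scalar_measure E (a - b))
      \<le> (sqrt (\<integral>t. \<phi> t \<partial>scalar_measure E a) + sqrt (\<integral>t. \<phi> t \<partial>scalar_measure E b))\<^sup>2"
proof -
  note sets = sets_scalar_measure[OF pvm]
  define p q where "p = (\<integral>t. \<phi> t \<partial>scalar_measure E a)" and "q = (\<integral>t. \<phi> t \<partial>scalar_measure E b)"
  have pq: "0 \<le> p" "0 \<le> q" using \<phi>(1) by (simp_all add: p_def q_def)
  have nn_bound: "(\<integral>\<^sup>+t. ennreal (\<phi> t) \<partial>scalar_measure E (a - b))
      \<le> ennreal ((1 + s) * p + (1 + 1 / s) * q)"
    if s: "0 < s" for s
  proof -
    have "(\<integral>\<^sup>+t. ennreal (\<phi> t) \<partial>scalar_measure E (a - b))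
        \<le> ennreal (1 + s) * (\<integral>\<^sup>+t. ennreal (\<phi> t) \<partial>scalar_measure E a)
          + ennreal (1 + 1 / s) * (\<integral>\<^sup>+t. ennreal (\<phi> t) \<partial>scalar_measure E b)"
    proof (rule nn_integral_le_of_measure_le)
      fix A assume "A \<in> sets (scalar_measure E (a - b))"
      then have A: "A \<in> sets borel" by (simp add: sets)
      have "E A (a - b) = E A a - E A b"
        using pvm_bounded_linear[OF pvm A] by (simp add: bounded_linear.linear linear_diff)
      then show "emeasure (scalar_measure E (a - b)) A
          \<le> ennreal (1 + s) * emeasure (scalar_measure E a) A + ennreal (1
              + 1 / s) * emeasure (scalar_measure E b) A"
        using norm_diff_square_le[OF s, of "E A a" "E A b"] s
        by (simp add: emeasure_scalar_measure[OF pvm A] flip: ennreal_mult ennreal_plus)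
    qed (simp_all add: sets)
    also have "\<dots> = ennreal (1 + s) * ennreal p + ennreal (1 + 1 / s) * ennreal q"
      using \<phi> by (simp add: p_def q_def nn_integral_eq_integral)
    also have "\<dots> = ennreal ((1 + s) * p + (1 + 1 / s) * q)"
      using s pq by (simp flip: ennreal_mult ennreal_plus)
    finally show ?thesis .
  qed
  have meas: "\<phi> \<in> borel_measurable (scalar_measure E (a - b))"
  proof -
    have "borel_measurable (scalar_measure E (a - b))
        = (borel_measurable (scalar_measure E a) :: (real \<Rightarrow> real) set)"
      by (rule measurable_cong_sets) (simp_all add: sets)
    then show ?thesis using borel_measurable_integrable[OF \<phi>(2)] by blast
  qed
  show int: "integrable (scalar_measure E (a - b)) \<phi>"
  proof (rule integrableI_bounded[OF meas])
    have "(\<integral>\<^sup>+t. ennreal (norm (\<phi> t)) \<partial>scalar_measure E (a - b))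
        \<le> ennreal ((1 + 1) * p + (1 + 1 / 1) * q)"
      using nn_bound[of 1] \<phi>(1) by simp
    then show "(\<integral>\<^sup>+t. ennreal (norm (\<phi> t)) \<partial>scalar_measure E (a - b)) < \<infinity>"
      by (rule le_less_trans) simp
  qed
  define I where "I = (\<integral>t. \<phi> t \<partial>scalar_measure E (a - b))"
  have bound: "I \<le> (1 + s) * p + (1 + 1 / s) * q" if s: "0 < s" for s
  proof -
    have "ennreal I \<le> ennreal ((1 + s) * p + (1 + 1 / s) * q)"
      using nn_bound[OF s] int \<phi>(1) by (simp add: I_def nn_integral_eq_integral)
    moreover have "0 \<le> (1 + s) * p + (1 + 1 / s) * q" using s pq by simp
    ultimately show ?thesis by (simp only: ennreal_le_iff)
  qed
  \<comment> \<open>The optimal \<open>s\<close> is \<open>sqrt q / sqrt p\<close>; the summand \<open>d\<close> keeps both roots away from zero.\<close>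
  have "I \<le> (sqrt p + d + (sqrt q + d))\<^sup>2" if d: "0 < d" for d
  proof -
    define P Q where "P = sqrt p + d" and "Q = sqrt q + d"
    have PQ: "0 < P" "0 < Q" using d pq by (simp_all add: P_def Q_def add_nonneg_pos)
    have "p \<le> P\<^sup>2" "q \<le> Q\<^sup>2"
      using power_mono[of "sqrt p" P 2] power_mono[of "sqrt q" Q 2] pq d by (simp_all add: P_def Q_def)
    have "I \<le> (1 + Q / P) * p + (1 + 1 / (Q / P)) * q" using PQ by (intro bound) simp
    also have "\<dots> \<le> (1 + Q / P) * P\<^sup>2 + (1 + 1 / (Q / P)) * Q\<^sup>2"
      using PQ \<open>p \<le> P\<^sup>2\<close> \<open>q \<le> Q\<^sup>2\<close> by (intro add_mono mult_left_mono) auto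
    also have "\<dots> = (P + Q)\<^sup>2" using PQ by (simp add: field_simps power2_eq_square)
    finally show ?thesis by (simp add: P_def Q_def)
  qed
  then have "I \<le> (sqrt p + inverse (real (Suc n)) + (sqrt q + inverse (real (Suc n))))\<^sup>2" for n
    by simp
  moreover have "(\<lambda>n. (sqrt p + inverse (real (Suc n)) + (sqrt q + inverse (real (Suc n))))\<^sup>2)
      \<longlonglongrightarrow> (sqrt p + 0 + (sqrt q + 0))\<^sup>2"
    by (intro tendsto_intros LIMSEQ_inverse_real_of_nat)
  ultimately have "I \<le> (sqrt p + 0 + (sqrt q + 0))\<^sup>2"
    by (intro LIMSEQ_le_const) auto
  then show "(\<integral>t. \<phi> t \<partial>scalar_measure E (a - b))
      \<le> (sqrt (\<integral>t. \<phi> t \<partial>scalar_measure E a) + sqrt (\<integral>t. \<phi> t \<partial>scalar_measure E b))\<^sup>2"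
    by (simp add: I_def p_def q_def)
qed

text \<open>This is \<open>(x, y) \<le> ((x, T\<^sup>-\<^sup>1 x) + (y, T y)) / 2\<close> in terms of the resolution of a positive
\<open>T\<close>. On a set where \<open>t\<close> is nearly a constant \<open>c\<close> it is the inequality \<open>2 (u, v) \<le> \<parallel>u\<parallel>\<^sup>2 / c + c
\<parallel>v\<parallel>\<^sup>2\<close>. The half-line is therefore cut into cells on which \<open>t\<close> varies by a factor of at most
\<open>exp d\<close>, and \<open>d\<close> tends to \<open>0\<close>.\<close>

lemma pvm_weighted_inner_le:
  assumes pvm: "projection_valued_measure E"
    and pos: "AE t in scalar_measure E x. 0 < t" "AE t in scalar_measure E y. 0 < t"
    and int: "integrable (scalar_measure E x) (\<lambda>t. 1 / t)" "integrable (scalar_measure E y) (\<lambda>t. t)"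
  shows "x \<bullet> y \<le> ((\<integral>t. 1 / t \<partial>scalar_measure E x) + (\<integral>t. t \<partial>scalar_measure E y)) / 2"
proof -
  define K L where "K = (\<integral>t. 1 / t \<partial>scalar_measure E x)" and "L = (\<integral>t. t \<partial>scalar_measure E y)"
  interpret X: finite_measure "scalar_measure E x" by (rule finite_scalar_measure[OF pvm])
  interpret Y: finite_measure "scalar_measure E y" by (rule finite_scalar_measure[OF pvm])
  note sets = sets_scalar_measure[OF pvm] and space = space_scalar_measure[OF pvm]
  have step: "x \<bullet> y \<le> (exp d * K + L) / 2" if d: "0 < d" for d
  proof -
    \<comment> \<open>The cell \<open>A n\<close> is \<open>[c n, exp d * c n)\<close>; the cells are indexed by the integers, encoded as
        naturals.\<close>
    define A where "A n = {t. 0 < t \<and> \<lfloor>ln t / d\<rfloor> = int_decode n}" for n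
    define c where "c n = exp (d * of_int (int_decode n))" for n
    have c: "0 < c n" for n by (simp add: c_def)
    have A: "A n \<in> sets borel" for n unfolding A_def by measurable
    have mem: "t \<in> A n \<longleftrightarrow> 0 < t \<and> n = int_encode \<lfloor>ln t / d\<rfloor>" for t n
      by (auto simp: A_def)
    have cell: "c (int_encode \<lfloor>ln t / d\<rfloor>) \<le> t" "t \<le> exp d * c (int_encode \<lfloor>ln t / d\<rfloor>)" if "0 < t" for t
    proof -
      have "d * of_int \<lfloor>ln t / d\<rfloor> \<le> d * (ln t / d)" using d by (intro mult_left_mono) auto
      then have "d * of_int \<lfloor>ln t / d\<rfloor> \<le> ln t" using d by simp
      then have "exp (d * of_int \<lfloor>ln t / d\<rfloor>) \<le> exp (ln t)" by simp
      then show "c (int_encode \<lfloor>ln t / d\<rfloor>) \<le> t" using that by (simp add: c_def)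
      have "d * (ln t / d) \<le> d * (of_int \<lfloor>ln t / d\<rfloor> + 1)" using d by (intro mult_left_mono) linarith+
      then have "ln t \<le> d + d * of_int \<lfloor>ln t / d\<rfloor>" using d by (simp add: distrib_left)
      then have "exp (ln t) \<le> exp (d + d * of_int \<lfloor>ln t / d\<rfloor>)" by simp
      then show "t \<le> exp d * c (int_encode \<lfloor>ln t / d\<rfloor>)" using that by (simp add: c_def exp_add)
    qed
    have sum_cells: "(\<Sum>n<N. v n * indicator (A n) t)
        = (if int_encode \<lfloor>ln t / d\<rfloor> < N then v (int_encode \<lfloor>ln t / d\<rfloor>) else 0)"
      if "0 < t" for N t and v :: "nat \<Rightarrow> real"
    proof -
      have "(\<Sum>n<N. v n * indicator (A n) t) = (\<Sum>n<N. if n = int_encode \<lfloor>ln t / d\<rfloor> then v n else 0)"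
        using that by (intro sum.cong) (auto simp: indicator_def mem)
      then show ?thesis by simp
    qed
    have one: "E (A n) x \<bullet> y \<le> (1 / c n * measure (scalar_measure E x) (A n)
        + c n * measure (scalar_measure E y) (A n)) / 2" for n
    proof -
      have "E (A n) x \<bullet> y = E (A n) x \<bullet> E (A n) y" by (rule pvm_inner[OF pvm A])
      also have "\<dots> \<le> (1 / c n * (norm (E (A n) x))\<^sup>2 + c n * (norm (E (A n) y))\<^sup>2) / 2"
      proof -
        have "0 \<le> 1 / c n * (norm (E (A n) x - c n *\<^sub>R E (A n) y))\<^sup>2" using c[of n] by simp
        also have "\<dots> = 1 / c n * (norm (E (A n) x))\<^sup>2 - 2 * (E (A n) x \<bullet> E (A n) y)
            + c n * (norm (E (A n) y))\<^sup>2"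
          using c[of n] by (simp add: power2_norm_eq_inner inner_diff_left inner_diff_right
              inner_commute field_simps)
        finally show ?thesis by simp
      qed
      finally show ?thesis by (simp add: measure_scalar_measure[OF pvm A])
    qed
    have intX: "integrable (scalar_measure E x) (\<lambda>t. v * indicator (A n) t)" for n and v :: real
      using A by (intro integrable_mult_right) (simp add: sets integrable_indicator_iff
          X.emeasure_eq_measure)
    have intY: "integrable (scalar_measure E y) (\<lambda>t. v * indicator (A n) t)" for n and v :: real
      using A by (intro integrable_mult_right) (simp add: sets integrable_indicator_iff
          Y.emeasure_eq_measure)
    have sumX: "(\<Sum>n<N. 1 / c n * measure (scalar_measure E x) (A n)) \<le> exp d * K" for N
    proof -
      have "(\<Sum>n<N. 1 / c n * measure (scalar_measure E x) (A n))
          = (\<integral>t. (\<Sum>n<N. 1 / c n * indicator (A n) t) \<partial>scalar_measure E x)"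
        using A intX by (subst Bochner_Integration.integral_sum) (auto simp: space)
      also have "\<dots> \<le> (\<integral>t. exp d * (1 / t) \<partial>scalar_measure E x)"
      proof (rule integral_mono_AE)
        show "AE t in scalar_measure E x. (\<Sum>n<N. 1 / c n * indicator (A n) t) \<le> exp d * (1 / t)"
          using pos(1)
        proof eventually_elim
          case (elim t)
          have "1 / c (int_encode \<lfloor>ln t / d\<rfloor>) \<le> exp d * (1 / t)"
            using cell(2)[OF elim] elim c by (simp add: field_simps)
          then show ?case using elim unfolding sum_cells[OF elim] by simp
        qed
      qed (intro Bochner_Integration.integrable_sum intX integrable_mult_right int)+
      also have "\<dots> = exp d * K" by (simp only: K_def integral_mult_right_zero)
      finally show ?thesis .
    qed
    have sumY: "(\<Sum>n<N. c n * measure (scalar_measure E y) (A n)) \<le> L" for N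
    proof -
      have "(\<Sum>n<N. c n * measure (scalar_measure E y) (A n))
          = (\<integral>t. (\<Sum>n<N. c n * indicator (A n) t) \<partial>scalar_measure E y)"
        using A intY by (subst Bochner_Integration.integral_sum) (auto simp: space)
      also have "\<dots> \<le> (\<integral>t. t \<partial>scalar_measure E y)"
      proof (rule integral_mono_AE)
        show "AE t in scalar_measure E y. (\<Sum>n<N. c n * indicator (A n) t) \<le> t"
          using pos(2)
        proof eventually_elim
          case (elim t)
          then show ?case using cell(1)[OF elim] unfolding sum_cells[OF elim] by simp
        qed
      qed (intro Bochner_Integration.integrable_sum intY int)+
      finally show ?thesis by (simp add: L_def)
    qed
    have partial: "(\<Sum>n<N. E (A n) x) \<bullet> y \<le> (exp d * K + L) / 2" for N
    proof -
      have "(\<Sum>n<N. E (A n) x) \<bullet> y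
          \<le> (\<Sum>n<N. (1 / c n * measure (scalar_measure E x) (A n)
              + c n * measure (scalar_measure E y) (A n)) / 2)"
        unfolding inner_sum_left by (intro sum_mono one)
      also have "\<dots> = ((\<Sum>n<N. 1 / c n * measure (scalar_measure E x) (A n))
          + (\<Sum>n<N. c n * measure (scalar_measure E y) (A n))) / 2"
        by (simp only: sum_divide_distrib[symmetric] sum.distrib)
      also have "\<dots> \<le> (exp d * K + L) / 2" using sumX[of N] sumY[of N] by simp
      finally show ?thesis .
    qed
    have x: "E (\<Union>n. A n) x = x"
    proof -
      have UA: "(\<Union>n. A n) = {0<..}" by (auto simp: mem)
      have "(norm (E {..0} x))\<^sup>2 = 0"
      proof -
        have "{..0::real} \<in> null_sets (scalar_measure E x)"
          using pos(1) by (subst AE_iff_null_sets) (auto simp: sets elim!: eventually_mono)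
        then have "emeasure (scalar_measure E x) {..0} = 0" by (rule null_setsD1)
        then show ?thesis using emeasure_scalar_measure[OF pvm, of "{..0}" x]
            by (simp add: ennreal_eq_0_iff)
      qed
      moreover have "E UNIV x = E {0<..} x + E {..0} x"
      proof -
        have "{0<..} \<inter> {..0::real} = {}" "{0<..} \<union> {..0::real} = UNIV" by auto
        then show ?thesis using pvm_disjoint_Un[OF pvm, of "{0<..}" "{..0}" x] by simp
      qed
      ultimately show ?thesis by (simp add: UA pvm_UNIV[OF pvm])
    qed
    have "disjoint_family A" by (auto simp: disjoint_family_on_def mem)
    then have "(\<lambda>n. E (A n) x) sums x" using pvm_sums[OF pvm, of A x] A x by auto
    then have "(\<lambda>N. (\<Sum>n<N. E (A n) x) \<bullet> y) \<longlonglongrightarrow> x \<bullet> y"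
      unfolding sums_def by (intro tendsto_intros)
    then show ?thesis using partial by (intro LIMSEQ_le_const2) auto
  qed
  have "(\<lambda>n. (exp (inverse (real (Suc n))) * K + L) / 2) \<longlonglongrightarrow> (exp 0 * K + L) / 2"
    by (intro tendsto_intros LIMSEQ_inverse_real_of_nat) simp
  then have "x \<bullet> y \<le> (exp 0 * K + L) / 2"
    using step by (intro LIMSEQ_le_const) auto
  then show ?thesis by (simp add: K_def L_def)
qed

section \<open>The stability estimate\<close>

text \<open>With \<open>v = B\<^sup>* y\<close> the preceding lemma reads \<open>2 (h, v) \<le> \<integral> 1/t d\<mu> + \<parallel>v\<parallel>\<^sup>2\<close>. The vectors \<open>v\<close>
of this form are dense since \<open>B\<close> is injective, and \<open>v = h\<close> gives the claim.\<close>

lemma norm_le_integral_inverse: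
  fixes B :: "'h::{real_inner, complete_space} \<Rightarrow> 'h"
  assumes B: "bounded_linear B" "inj B"
    and res: "spectral_resolution (B \<circ> adjoint B) E"
    and pos: "\<And>y. AE t in scalar_measure E y. 0 < t"
    and int: "integrable (scalar_measure E (B h)) (\<lambda>t. 1 / t)"
  shows "(norm h)\<^sup>2 \<le> (\<integral>t. 1 / t \<partial>scalar_measure E (B h))"
proof -
  define K where "K = (\<integral>t. 1 / t \<partial>scalar_measure E (B h))"
  note adj = inner_adjoint_hilbert[OF B(1)]
  have "h \<bullet> adjoint B y \<le> (K + (norm (adjoint B y))\<^sup>2) / 2" for y
  proof -
    have "h \<bullet> adjoint B y = B h \<bullet> y" by (simp add: adj)
    also have "\<dots> \<le> (K + (\<integral>t. t \<partial>scalar_measure E y)) / 2"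
      unfolding K_def using res pos int
      by (intro pvm_weighted_inner_le) (auto simp: spectral_resolution_def)
    also have "(\<integral>t. t \<partial>scalar_measure E y) = y \<bullet> B (adjoint B y)"
      using res by (simp add: spectral_resolution_def)
    also have "y \<bullet> B (adjoint B y) = (norm (adjoint B y))\<^sup>2"
      by (metis adj inner_commute power2_norm_eq_inner)
    finally show ?thesis .
  qed
  then have "2 * (h \<bullet> adjoint B y) \<le> K + (norm (adjoint B y))\<^sup>2" for y
    by (simp add: mult.commute)
  then have "range (adjoint B) \<subseteq> {v. 2 * (h \<bullet> v) \<le> K + (norm v)\<^sup>2}" by blast
  moreover have "closed {v. 2 * (h \<bullet> v) \<le> K + (norm v)\<^sup>2}"
    by (intro closed_Collect_le continuous_intros)
  ultimately have "closure (range (adjoint B)) \<subseteq> {v. 2 * (h \<bullet> v) \<le> K + (norm v)\<^sup>2}"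
    by (rule closure_minimal)
  moreover have "closure (range (adjoint B)) = UNIV"
  proof (rule dense_subspaceI)
    show "subspace (range (adjoint B))"
      using bounded_linear_adjoint[OF B(1)] by (intro linear_subspace_image bounded_linear.linear) auto
    fix v assume "\<And>w. w \<in> range (adjoint B) \<Longrightarrow> v \<bullet> w = 0"
    then have "B v \<bullet> B v = 0" by (simp add: adj)
    then have "B v = B 0" using B(1) by (simp add: bounded_linear.linear linear_0)
    then show "v = 0" using B(2) by (simp add: inj_eq)
  qed
  ultimately have "2 * (h \<bullet> h) \<le> K + (norm h)\<^sup>2" by blast
  then show ?thesis by (simp add: K_def power2_norm_eq_inner)
qed

text \<open>Jensen's inequality through a supporting line of \<open>\<Psi>\<close> at the mean \<open>m\<close>. Integrability of \<open>w\<close>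
is part of the conclusion, since \<open>w\<close> lies below an affine function of \<open>\<phi>\<close>. The interval \<open>S\<close> may
contain its left end point, where \<open>\<Psi>\<close> need not be continuous and no supporting line need exist;
but a mean at the end point forces \<open>\<phi>\<close> to be constant almost everywhere.\<close>

lemma integral_le_concave_mean:
  fixes w \<phi> :: "'a \<Rightarrow> real" and \<Psi> :: "real \<Rightarrow> real"
  assumes fin: "finite_measure \<mu>" and s: "measure \<mu> (space \<mu>) = s" "0 < s"
    and w: "w \<in> borel_measurable \<mu>" "AE t in \<mu>. 0 \<le> w t" "AE t in \<mu>. w t \<le> \<Psi> (\<phi> t)"
    and \<phi>: "integrable \<mu> \<phi>" "AE t in \<mu>. \<phi> t \<in> S"
    and S: "{a<..} \<subseteq> S" and \<Psi>: "mono_on S \<Psi>" "concave_on S \<Psi>"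
    and P: "(\<integral>t. \<phi> t \<partial>\<mu>) / s \<le> P"
  shows "integrable \<mu> w" and "(\<integral>t. w t \<partial>\<mu>) \<le> s * \<Psi> P"
proof -
  interpret finite_measure \<mu> by fact
  define m where "m = (\<integral>t. \<phi> t \<partial>\<mu>) / s"
  have m_int: "(\<integral>t. \<phi> t \<partial>\<mu>) = m * s" using s by (simp add: m_def)
  have conv: "convex_on S (\<lambda>x. - \<Psi> x)" using \<Psi>(2) by (simp add: concave_on_def)
  then have "convex S" by (simp add: convex_on_def)
  then have interval: "z \<in> S" if "x \<in> S" "y \<in> S" "x \<le> z" "z \<le> y" for x y z
    using that by (meson is_interval_convex_1 mem_is_interval_1_I)
  have up: "z \<in> S" if "x \<in> S" "x \<le> z" for x z
  proof -
    have "max z a + 1 \<in> S" by (rule subsetD[OF S]) simp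
    then show ?thesis by (rule interval[OF that(1) _ that(2)]) simp
  qed
  have "\<exists>k. m \<in> S \<and> (AE t in \<mu>. w t \<le> \<Psi> m + k * (\<phi> t - m))"
  proof (cases "m \<in> interior S")
    case True
    define k where "k = Inf ((\<lambda>t. (- \<Psi> m - - \<Psi> t) / (m - t)) ` ({m<..} \<inter> S))"
    have "- \<Psi> y \<ge> - \<Psi> m + k * (y - m)" if "y \<in> S" for y
      unfolding k_def by (rule convex_le_Inf_differential[OF conv True that])
    then have le: "\<Psi> y \<le> \<Psi> m + (- k) * (y - m)" if "y \<in> S" for y
      using that by fastforce
    have "AE t in \<mu>. w t \<le> \<Psi> m + (- k) * (\<phi> t - m)"
      using w(3) \<phi>(2) by eventually_elim (use le in \<open>blast intro: order_trans\<close>)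
    then show ?thesis using True interior_subset by blast
  next
    case False
    have "m \<le> y" if "y \<in> S" for y
    proof (rule ccontr)
      assume "\<not> m \<le> y"
      then have "m \<in> {y<..}" by simp
      moreover have "{y<..} \<subseteq> S" using up[OF that] by auto
      ultimately show False using False interior_maximal[of "{y<..}" S] by auto
    qed
    then have ge: "AE t in \<mu>. 0 \<le> \<phi> t - m" using \<phi>(2) by (auto elim: eventually_mono)
    have "(\<integral>t. \<phi> t - m \<partial>\<mu>) = 0" using \<phi>(1) s m_int by simp
    then have "AE t in \<mu>. \<phi> t - m = 0"
      using integral_nonneg_eq_0_iff_AE[OF _ ge] \<phi>(1) by simp
    then have eq: "AE t in \<mu>. \<phi> t = m" by simp
    have "\<exists>t. \<phi> t = m \<and> \<phi> t \<in> S"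
    proof (rule ccontr)
      assume none: "\<nexists>t. \<phi> t = m \<and> \<phi> t \<in> S"
      have "AE t in \<mu>. \<phi> t = m \<and> \<phi> t \<in> S" using eq \<phi>(2) by eventually_elim simp
      then have "AE t in \<mu>. False" using none by (auto elim: eventually_mono)
      then have "emeasure \<mu> (space \<mu>) = 0" by (simp add: AE_iff_null null_sets_def)
      then show False using s by (simp add: measure_def)
    qed
    moreover have "AE t in \<mu>. w t \<le> \<Psi> m + 0 * (\<phi> t - m)"
      using w(3) eq by eventually_elim simp
    ultimately show ?thesis by blast
  qed
  then obtain k where "m \<in> S" and k: "AE t in \<mu>. w t \<le> \<Psi> m + k * (\<phi> t - m)" by blast
  have int: "integrable \<mu> (\<lambda>t. \<Psi> m + k * (\<phi> t - m))" using \<phi>(1) by simp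
  show "integrable \<mu> w"
  proof (rule Bochner_Integration.integrable_bound[OF int w(1)])
    show "AE t in \<mu>. norm (w t) \<le> norm (\<Psi> m + k * (\<phi> t - m))"
      using w(2) k by eventually_elim simp
  qed
  then have "(\<integral>t. w t \<partial>\<mu>) \<le> (\<integral>t. \<Psi> m + k * (\<phi> t - m) \<partial>\<mu>)"
    using int k by (intro integral_mono_AE)
  also have "\<dots> = s * \<Psi> m" using \<phi>(1) s m_int by simp
  also have "\<dots> \<le> s * \<Psi> P"
  proof -
    have "\<Psi> m \<le> \<Psi> P"
      using up[OF \<open>m \<in> S\<close>] P \<open>m \<in> S\<close> mono_onD[OF \<Psi>(1)] by (simp add: m_def)
    then show ?thesis using s by simp
  qed
  finally show "(\<integral>t. w t \<partial>\<mu>) \<le> s * \<Psi> P" .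
qed

text \<open>The operator \<open>B B\<^sup>*\<close> is symmetric with \<open>0 \<le> (x, B B\<^sup>* x) = \<parallel>B\<^sup>* x\<parallel>\<^sup>2 \<le> (K\<^sup>2 + 1) \<parallel>x\<parallel>\<^sup>2\<close>,
where \<open>K\<close> bounds \<open>B\<^sup>*\<close>; the added \<open>1\<close> makes the upper bound strictly positive.\<close>

lemma ex_spectral_resolution:
  fixes B :: "'h::{real_inner, complete_space} \<Rightarrow> 'h"
  assumes "bounded_linear B"
  shows "\<exists>E. spectral_resolution (B \<circ> adjoint B) E"
proof -
  interpret A: bounded_linear "adjoint B" by (rule bounded_linear_adjoint[OF assms])
  obtain K where K: "\<And>x. norm (adjoint B x) \<le> norm x * K" using A.bounded by blast
  have adj: "x \<bullet> B y = adjoint B x \<bullet> y" for x y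
    using inner_adjoint_hilbert[OF assms, of y x] by (simp add: inner_commute)
  have "positive_operator (B \<circ> adjoint B) (K\<^sup>2 + 1)"
  proof (rule positive_operator.intro)
    show "linear (B \<circ> adjoint B)"
      using A.linear bounded_linear.linear[OF assms] by (rule linear_compose)
    show "(B \<circ> adjoint B) x \<bullet> y = x \<bullet> (B \<circ> adjoint B) y" for x y
      using adj[of y "adjoint B x"] by (simp add: adj inner_commute)
    show "0 \<le> x \<bullet> (B \<circ> adjoint B) x" for x by (simp add: adj)
    show "x \<bullet> (B \<circ> adjoint B) x \<le> (K\<^sup>2 + 1) * (x \<bullet> x)" for x
    proof -
      have "(norm (adjoint B x))\<^sup>2 \<le> (norm x * K)\<^sup>2" using K by (intro power_mono) auto
      also have "\<dots> \<le> (K\<^sup>2 + 1) * (norm x)\<^sup>2" by (simp add: power_mult_distrib algebra_simps)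
      finally show ?thesis by (simp add: adj power2_norm_eq_inner)
    qed
    show "0 < K\<^sup>2 + 1" by (simp add: add_nonneg_pos)
  qed
  then show ?thesis using positive_operator.spectral_resolution_spectral_proj by blast
qed

theorem theorem1:
  fixes B :: "'a::{real_normed_field, euclidean_space} L2 \<Rightarrow> 'a L2"
    and \<psi> \<Psi> :: "real \<Rightarrow> real" and D S :: "real set"
    and c\<^sub>0 C \<epsilon> :: real and f f\<^sub>\<alpha> g :: "'a L2"
  assumes "bounded_linear B" and "inj B"
    and "c\<^sub>0 > 0"
    and "\<And>t. 0 \<le> t \<Longrightarrow> t \<le> c\<^sub>0 \<Longrightarrow> inj (\<lambda>h. B (adjoint B h) - t *\<^sub>R h)"
    (* psi is a function on D, and psi of the inverse of B B* is defined *)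
    and "D \<subseteq> {0<..}"
    and "\<And>h. AE t in spectral_measure (B \<circ> adjoint B) h. 1 / t \<in> D"
    and "continuous_on D \<psi>"
    and "\<And>t. t \<in> D \<Longrightarrow> \<psi> t \<ge> 0"
    and "mono_on (D \<inter> {1 / c\<^sub>0<..}) \<psi>"
    (* Psi is a function on S *)
    and "{1 / c\<^sub>0<..} \<subseteq> S" and "\<psi> ` D \<subseteq> S"
    and "\<And>y. y \<in> S \<Longrightarrow> \<Psi> y \<ge> 0"
    and "\<And>t. t \<in> D \<Longrightarrow> \<Psi> (\<psi> t) \<ge> t"
    and "mono_on S \<Psi>" and "concave_on S \<Psi>"
    and "f\<^sub>\<alpha> \<in> H_space B D \<psi>"
    and "B f\<^sub>\<alpha> \<in> H_space B D \<psi>" and "H_norm B D \<psi> (B f\<^sub>\<alpha>) \<le> C"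
    and "norm (B f\<^sub>\<alpha> - g) = \<epsilon>"
    and "g = B f" and "g \<in> H_space B D \<psi>"
  shows "norm (f - f\<^sub>\<alpha>) \<le> \<epsilon> * sqrt (\<Psi> ((C + H_norm B D \<psi> g)\<^sup>2 / \<epsilon>\<^sup>2))"
proof (cases "\<epsilon> = 0")
  case True
  then have "B f\<^sub>\<alpha> = B f" using assms(19,20) by simp
  then have "f\<^sub>\<alpha> = f" using \<open>inj B\<close> by (simp add: inj_eq)
  then show ?thesis using True by simp
next
  case False
  define E where "E = (SOME E. spectral_resolution (B \<circ> adjoint B) E)"
  have res: "spectral_resolution (B \<circ> adjoint B) E"
    unfolding E_def by (rule someI_ex[OF ex_spectral_resolution[OF assms(1)]])
  have spec: "spectral_measure (B \<circ> adjoint B) h = scalar_measure E h" for h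
    by (simp add: spectral_measure_def E_def)
  have pvm: "projection_valued_measure E" using res by (simp add: spectral_resolution_def)
  have inD: "AE t in scalar_measure E h. 1 / t \<in> D" for h using assms(6)[of h] unfolding spec .
  have pos: "AE t in scalar_measure E h. 0 < t" for h
    using inD[of h] by eventually_elim (use assms(5) in \<open>auto simp: zero_less_divide_iff\<close>)
  \<comment> \<open>Membership in \<open>H_space B D \<psi>\<close> makes this product measurable as a whole.\<close>
  define \<phi> where "\<phi> t = indicator {t. 1 / t \<in> D} t *\<^sub>R \<psi> (1 / t)" for t
  have \<phi>_nonneg: "0 \<le> \<phi> t" for t using assms(8) by (simp add: \<phi>_def indicator_def)
  define G where "G = H_norm B D \<psi> g"
  have \<phi>_g: "integrable (scalar_measure E g) \<phi>" "G = sqrt (\<integral>t. \<phi> t \<partial>scalar_measure E g)"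
    using assms(21) by (simp_all add: H_space_def H_norm_def G_def spec set_integrable_def
      set_lebesgue_integral_def \<phi>_def[abs_def])
  have \<phi>_a: "integrable (scalar_measure E (B f\<^sub>\<alpha>)) \<phi>" "sqrt (\<integral>t. \<phi> t \<partial>scalar_measure E (B f\<^sub>\<alpha>)) \<le> C"
    using assms(17,18) by (simp_all add: H_space_def H_norm_def spec set_integrable_def
      set_lebesgue_integral_def \<phi>_def[abs_def])
  define h where "h = f - f\<^sub>\<alpha>"
  have Bh: "B h = g - B f\<^sub>\<alpha>"
    using assms(1,20) by (simp add: h_def bounded_linear.linear linear_diff)
  have norm_Bh: "norm (B h) = \<epsilon>" using assms(19) by (simp add: Bh norm_minus_commute)
  define P where "P = (C + G)\<^sup>2 / \<epsilon>\<^sup>2"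
  have \<phi>_h: "integrable (scalar_measure E (B h)) \<phi>"
    unfolding Bh by (rule scalar_measure_triangle(1)[OF pvm \<phi>_nonneg \<phi>_g(1) \<phi>_a(1)])
  have "(\<integral>t. \<phi> t \<partial>scalar_measure E (B h)) \<le> (G + sqrt (\<integral>t. \<phi> t \<partial>scalar_measure E (B f\<^sub>\<alpha>)))\<^sup>2"
    unfolding Bh \<phi>_g(2) by (rule scalar_measure_triangle(2)[OF pvm \<phi>_nonneg \<phi>_g(1) \<phi>_a(1)])
  also have "\<dots> \<le> (C + G)\<^sup>2"
  proof (rule power_mono)
    have "0 \<le> G" unfolding \<phi>_g(2) using \<phi>_nonneg by simp
    then show "0 \<le> G + sqrt (\<integral>t. \<phi> t \<partial>scalar_measure E (B f\<^sub>\<alpha>))" using \<phi>_nonneg by simp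
  qed (use \<phi>_a(2) in simp)
  finally have mean: "(\<integral>t. \<phi> t \<partial>scalar_measure E (B h)) / \<epsilon>\<^sup>2 \<le> P"
    by (simp add: P_def divide_right_mono)
  have total: "measure (scalar_measure E (B h)) (space (scalar_measure E (B h))) = \<epsilon>\<^sup>2"
    by (simp add: space_scalar_measure[OF pvm] measure_scalar_measure[OF pvm] pvm_UNIV[OF pvm] norm_Bh)
  have inv_meas: "(\<lambda>t. 1 / t :: real) \<in> borel_measurable (scalar_measure E (B h))"
    unfolding measurable_cong_sets[OF sets_scalar_measure[OF pvm] refl] by simp
  have inv_nonneg: "AE t in scalar_measure E (B h). 0 \<le> 1 / t"
    using pos by eventually_elim simp
  have inv_le: "AE t in scalar_measure E (B h). 1 / t \<le> \<Psi> (\<phi> t)"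
    using inD by eventually_elim (simp add: \<phi>_def assms(13))
  have \<phi>_S: "AE t in scalar_measure E (B h). \<phi> t \<in> S"
    using inD by eventually_elim (use assms(11) in \<open>auto simp: \<phi>_def\<close>)
  have eps: "0 < \<epsilon>\<^sup>2" using False by simp
  note jensen = integral_le_concave_mean[OF finite_scalar_measure[OF pvm] total eps inv_meas inv_nonneg
      inv_le \<phi>_h \<phi>_S assms(10,14,15) mean]
  have "(norm h)\<^sup>2 \<le> (\<integral>t. 1 / t \<partial>scalar_measure E (B h))"
    by (rule norm_le_integral_inverse[OF assms(1,2) res pos jensen(1)])
  also have "\<dots> \<le> \<epsilon>\<^sup>2 * \<Psi> P" by (rule jensen(2))
  finally have "sqrt ((norm h)\<^sup>2) \<le> sqrt (\<epsilon>\<^sup>2 * \<Psi> P)" by (rule real_sqrt_le_mono)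
  moreover have "0 \<le> \<epsilon>" using assms(19) norm_ge_zero by metis
  ultimately show ?thesis by (simp add: real_sqrt_mult h_def P_def G_def)
qed

end
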